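(* Let $W\in\mathbb{R}^{m\times n}$ have iid standard normal entries and let $m/n\to c$ as $n\to\infty$. If $c<c^*$, then the probability that the map $x\mapsto\operatorname{ReLU}(Wx)$, $\mathbb{R}^n\to\mathbb{R}^m$, is not injective tends to $1$ as $n\to\infty$, where $c^*$ is the unique positive real solution of $\frac12\mathrm{erfc}\!\left(\frac{1}{\sqrt{2c}}\right)=\frac1c$ (numerically $c^*\approx 3.4$).
   Context: $\operatorname{ReLU}(y)=\max(y,0)$ componentwise; $\mathrm{erfc}(z)=1-\frac{2}{\sqrt\pi}\int_0^z e^{-t^2}\,dt$. *)

theory Defs
  imports "HOL-Probability.Probability"
begin

definition erfc :: "real \<Rightarrow> real" where
  "erfc z = 1 - 2 / sqrt pi * (LBINT t=0..z. exp (- (t\<^sup>2)))"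

definition c_star :: real where
  "c_star = (THE c. c > 0 \<and> erfc (1 / sqrt (2 * c)) / 2 = 1 / c)"

definition gauss_matrix :: "nat \<Rightarrow> nat \<Rightarrow> (nat \<times> nat \<Rightarrow> real) measure" where
  "gauss_matrix m n = PiM ({..<m} \<times> {..<n}) (\<lambda>_. density lborel std_normal_density)"

text \<open>The map x |-> ReLU(W x) from R^n (extensional functions on {..<n}) to R^m.\<close>
definition relu_layer :: "nat \<Rightarrow> nat \<Rightarrow> (nat \<times> nat \<Rightarrow> real) \<Rightarrow> (nat \<Rightarrow> real) \<Rightarrow> (nat \<Rightarrow> real)" where
  "relu_layer m n W x = (\<lambda>i\<in>{..<m}. max (\<Sum>j<n. W (i, j) * x j) 0)"

end

theory Submission
  imports Defs
begin

text \<open>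
  Let \<open>s\<close> be the sum of the rows \<open>w_i\<close> of \<open>W\<close>. If fewer than \<open>n\<close> rows satisfy
  \<open><w_i, s> \<le> 0\<close>, some nonzero \<open>v\<close> is orthogonal to all of these rows, and the layer
  does not separate \<open>- s\<close> from \<open>- s + \<epsilon> v\<close> for small \<open>\<epsilon>\<close>. The normalised scores
  \<open><w_i, s> / sqrt (m n)\<close> are asymptotically normal with mean \<open>1 / sqrt c\<close> and variance 1, and
  any two of them are asymptotically independent, so by Chebyshev's inequality about
  \<open>m * erfc (1 / sqrt (2 c)) / 2\<close> rows qualify, which is less than \<open>n\<close> exactly when
  \<open>c < c_star\<close>.

  Asymptotic independence is read off the joint characteristic function, which is an \<open>n\<close>-th
  power because the columns of \<open>W\<close> are independent. The two-dimensional continuity theorem is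
  obtained by applying Levy's theorem twice, first to laws tilted by \<open>2 + cos (s X + \<phi>)\<close>.
\<close>

section \<open>Non-injectivity of a ReLU layer\<close>

text \<open>For a direction chosen independently of \<open>W\<close>, each row is active with
  probability 1/2, so the kernel argument would only reach \<open>c < 2\<close>. The row sum S
  biases all rows at once: <w_i, S> is |w_i|^2, which is about n, plus a contribution of the other
  rows that fluctuates on the scale sqrt (m n). Division by sqrt (m n) turns the bias into sqrt (n /
  m), hence the limit mean 1 / sqrt c, and a row stays active at -S with limit probability Phi (-1 /
  sqrt c) = erfc (1 / sqrt (2 c)) / 2, where Phi is the normal distribution function. The price is
  that S involves every row, so the activity indicators are dependent. Chebyshev's inequality asks
  only for pairwise decorrelation, which the limit law of two scores provides: the limit exponent in
  \<open>tendsto_pair_char_power\<close> has no mixed term in the two frequencies.\<close>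

lemma underdetermined_system_solution:
  fixes a :: "'i \<Rightarrow> 'j \<Rightarrow> real"
  assumes "finite A" "finite J" "card A < card J"
  shows "\<exists>v. (\<exists>j\<in>J. v j \<noteq> 0) \<and> (\<forall>i\<in>A. (\<Sum>j\<in>J. a i j * v j) = 0)"
  using assms
proof (induction A arbitrary: J a rule: finite_induct)
  case empty
  then have "J \<noteq> {}" by auto
  then show ?case by (intro exI[of _ "\<lambda>_. 1"]) auto
next
  case (insert i A)
  show ?case
  proof (cases "\<forall>j\<in>J. a i j = 0")
    case True
    have "card A < card J" using insert by simp
    then obtain v where "\<exists>j\<in>J. v j \<noteq> 0" "\<forall>i\<in>A. (\<Sum>j\<in>J. a i j * v j) = 0"
      using insert.IH[OF insert.prems(1), of a] by auto
    then show ?thesis using True by (intro exI[of _ v]) auto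
  next
    \<comment> \<open>Gaussian elimination with pivot \<open>p\<close> in equation \<open>i\<close>.
      Clearing column \<open>p\<close> changes both the coefficients and the set of unknowns, which
      is why the induction generalises over \<open>a\<close> and \<open>J\<close>.\<close>
    case False
    then obtain p where p: "p \<in> J" "a i p \<noteq> 0" by auto
    define J' where "J' = J - {p}"
    have J: "J = insert p J'" "p \<notin> J'" "finite J'" using p insert.prems by (auto simp: J'_def)
    have "card A < card J'" using insert J by simp
    from insert.IH[OF J(3) this, of "\<lambda>l j. a l j - a l p * a i j / a i p"]
    obtain v where v: "\<exists>j\<in>J'. v j \<noteq> 0"
      "\<forall>l\<in>A. (\<Sum>j\<in>J'. (a l j - a l p * a i j / a i p) * v j) = 0" by auto
    \<comment> \<open>Back substitution: the value at \<open>p\<close> is chosen to satisfy equation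
      \<open>i\<close>, and the nonzero entry of \<open>v\<close> lies in \<open>J'\<close>, so it
      survives.\<close>
    define u where "u = v(p := - (\<Sum>j\<in>J'. a i j * v j) / a i p)"
    have u: "(\<Sum>j\<in>J. a l j * u j) = a l p * u p + (\<Sum>j\<in>J'. a l j * v j)" for l
      unfolding J(1) using J by (auto simp: u_def intro!: sum.cong)
    have "(\<Sum>j\<in>J. a l j * u j) = 0" if "l \<in> A" for l
    proof -
      have "0 = (\<Sum>j\<in>J'. (a l j - a l p * a i j / a i p) * v j)" using v that by auto
      also have "\<dots> = (\<Sum>j\<in>J'. a l j * v j) - a l p / a i p * (\<Sum>j\<in>J'. a i j * v j)"
        unfolding sum_distrib_left sum_subtractf[symmetric]
        using p by (intro sum.cong refl) (simp add: field_simps)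
      finally show ?thesis unfolding u by (simp add: u_def)
    qed
    moreover have "(\<Sum>j\<in>J. a i j * u j) = 0" unfolding u using p by (simp add: u_def)
    moreover have "\<exists>j\<in>J. u j \<noteq> 0" using v(1) J by (auto simp: u_def)
    ultimately show ?thesis by (intro exI[of _ u]) auto
  qed
qed

lemma relu_layer_eq_iff:
  "relu_layer m n W x = relu_layer m n W y \<longleftrightarrow>
    (\<forall>i<m. max (\<Sum>j<n. W (i, j) * x j) 0 = max (\<Sum>j<n. W (i, j) * y j) 0)"
  unfolding relu_layer_def by (auto simp: fun_eq_iff restrict_def)

text \<open>A kernel vector of the rows active at \<open>-s\<close> can be added to \<open>-s\<close>, suitably scaled,
  without activating a further row.\<close>
lemma relu_layer_not_inj:
  assumes "card {i. i < m \<and> (\<Sum>j<n. W (i, j) * s j) \<le> 0} < n"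
  shows "\<not> inj_on (relu_layer m n W) ({..<n} \<rightarrow>\<^sub>E (UNIV :: real set))"
proof -
  \<comment> \<open>Rows with score exactly 0 belong to \<open>A\<close>: at \<open>- s\<close> they
    sit on the kink of ReLU, and a perturbation could activate them. Rows outside \<open>A\<close>
    are strictly inactive, which is an open condition.\<close>
  define A where "A = {i. i < m \<and> (\<Sum>j<n. W (i, j) * s j) \<le> 0}"
  have "finite A" "card A < card {..<n}" using assms by (auto simp: A_def)
  from underdetermined_system_solution[OF this(1) _ this(2), of "\<lambda>i j. W (i, j)"]
  obtain v p where v: "p < n" "v p \<noteq> 0" "\<forall>i\<in>A. (\<Sum>j<n. W (i, j) * v j) = 0" by auto
  define r where "r i = (\<Sum>j<n. W (i, j) * v j)" for i
  define q where "q i = (\<Sum>j<n. W (i, j) * s j)" for i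
  have "\<forall>\<^sub>F e in at_right 0. e * r i < q i" if "i \<in> {..<m} - A" for i
  proof -
    have "((\<lambda>e. e * r i) \<longlongrightarrow> 0 * r i) (at_right 0)" by (intro tendsto_intros)
    moreover have "q i > 0" using that by (auto simp: A_def q_def)
    ultimately show ?thesis by (intro order_tendstoD(2)) auto
  qed
  then have "\<forall>\<^sub>F e in at_right 0. \<forall>i\<in>{..<m} - A. e * r i < q i"
    by (intro eventually_ball_finite) auto
  moreover have "\<forall>\<^sub>F e in at_right (0::real). e > 0" by (simp add: eventually_at_right_less)
  ultimately have "\<forall>\<^sub>F e in at_right 0. (\<forall>i\<in>{..<m} - A. e * r i < q i) \<and> e > 0"
    by eventually_elim auto
  then obtain e where e: "\<And>i. i \<in> {..<m} - A \<Longrightarrow> e * r i < q i" "e > 0"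
    using eventually_happens'[OF trivial_limit_at_right_real] by blast
  define x where "x = (\<lambda>j\<in>{..<n}. - s j)"
  define y where "y = (\<lambda>j\<in>{..<n}. - s j + e * v j)"
  have X: "(\<Sum>j<n. W (i, j) * x j) = - q i" for i
    by (simp add: x_def q_def sum_negf[symmetric])
  have Y: "(\<Sum>j<n. W (i, j) * y j) = - q i + e * r i" for i
    by (simp add: y_def q_def r_def sum_negf[symmetric] sum_distrib_left sum.distrib[symmetric] algebra_simps)
  have "relu_layer m n W x = relu_layer m n W y"
    unfolding relu_layer_eq_iff X Y
  proof safe
    fix i assume "i < m"
    show "max (- q i) 0 = max (- q i + e * r i) 0"
    proof (cases "i \<in> A")
      case True
      then show ?thesis using v by (simp add: r_def)
    next
      case False
      with \<open>i < m\<close> have "e * r i < q i" "q i > 0" using e by (auto simp: A_def q_def)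
      then show ?thesis by simp
    qed
  qed
  moreover have "x p \<noteq> y p" using v e by (simp add: x_def y_def)
  moreover have "x \<in> {..<n} \<rightarrow>\<^sub>E UNIV" "y \<in> {..<n} \<rightarrow>\<^sub>E UNIV" by (auto simp: x_def y_def)
  ultimately show ?thesis unfolding inj_on_def by metis
qed

section \<open>Measurability of the non-injectivity event\<close>

definition relu_gap :: "nat \<Rightarrow> nat \<Rightarrow> (nat \<times> nat \<Rightarrow> real) \<Rightarrow> (nat \<Rightarrow> real) \<Rightarrow> (nat \<Rightarrow> real) \<Rightarrow> real" where
  "relu_gap m n W x y =
    (\<Sum>i<m. \<bar>max (\<Sum>j<n. W (i, j) * x j) 0 - max (\<Sum>j<n. W (i, j) * y j) 0\<bar>)"

lemma relu_gap_cong: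
  "(\<And>j. j < n \<Longrightarrow> x j = x' j) \<Longrightarrow> (\<And>j. j < n \<Longrightarrow> y j = y' j) \<Longrightarrow>
    relu_gap m n W x y = relu_gap m n W x' y'"
  unfolding relu_gap_def by simp

lemma relu_gap_nonneg: "relu_gap m n W x y \<ge> 0"
  unfolding relu_gap_def by (simp add: sum_nonneg)

lemma relu_gap_eq_0_iff: "relu_gap m n W x y = 0 \<longleftrightarrow> relu_layer m n W x = relu_layer m n W y"
  unfolding relu_gap_def relu_layer_eq_iff by (subst sum_nonneg_eq_0_iff) auto

text \<open>Equality of outputs becomes the vanishing of a continuous function, and extensionality
  is dropped so that inputs can be perturbed coordinate by coordinate.\<close>

lemma relu_layer_not_inj_iff:
  "\<not> inj_on (relu_layer m n W) ({..<n} \<rightarrow>\<^sub>E (UNIV :: real set)) \<longleftrightarrow>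
    (\<exists>x y. (\<exists>j<n. x j \<noteq> y j) \<and> relu_gap m n W x y = 0)" (is "?L \<longleftrightarrow> ?R")
proof
  assume ?L
  then obtain x y where xy: "x \<in> {..<n} \<rightarrow>\<^sub>E UNIV" "y \<in> {..<n} \<rightarrow>\<^sub>E (UNIV :: real set)" "x \<noteq> y"
    "relu_layer m n W x = relu_layer m n W y" unfolding inj_on_def by auto
  then have "\<exists>j<n. x j \<noteq> y j" by (metis PiE_ext lessThan_iff)
  then show ?R using xy relu_gap_eq_0_iff by blast
next
  assume ?R
  then obtain x y j where xy: "j < n" "x j \<noteq> y j" "relu_gap m n W x y = 0" by auto
  have "relu_gap m n W (restrict x {..<n}) (restrict y {..<n}) = relu_gap m n W x y"
    by (rule relu_gap_cong) auto
  then have "relu_layer m n W (restrict x {..<n}) = relu_layer m n W (restrict y {..<n})"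
    using xy relu_gap_eq_0_iff by metis
  moreover have "restrict x {..<n} j \<noteq> restrict y {..<n} j" using xy by auto
  ultimately show ?L unfolding inj_on_def
    by (metis restrict_PiE_iff UNIV_I)
qed

text \<open>Tychonoff's theorem. It allows inputs to remain functions on all of \<open>nat\<close>
  in the minimisation below.\<close>

lemma compact_bounded_functions: "compact {x :: nat \<Rightarrow> real. \<forall>l. \<bar>x l\<bar> \<le> k}"
proof -
  have "compactin (product_topology (\<lambda>_. euclidean) UNIV) (PiE UNIV (\<lambda>_::nat. {-k..k}))"
    by (subst compactin_PiE) auto
  moreover have "{x :: nat \<Rightarrow> real. \<forall>l. \<bar>x l\<bar> \<le> k} = PiE UNIV (\<lambda>_. {-k..k})"
    by (auto simp: PiE_def abs_le_iff minus_le_iff)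
  ultimately show ?thesis by (simp add: euclidean_product_topology)
qed

lemma rational_sequence_tendsto: "\<exists>q::nat \<Rightarrow> real. (\<forall>e. q e \<in> \<rat>) \<and> q \<longlonglongrightarrow> x"
proof -
  have "x \<in> closure \<rat>" by (simp add: Rats_closure_real)
  then show ?thesis unfolding closure_sequential by auto
qed

text \<open>Bounding the inputs by \<open>k\<close> and keeping coordinate \<open>j\<close> apart by
  \<open>1 / Suc k\<close> confines the pairs to a compact set, on which the continuous gap attains
  its minimum. Arbitrarily small gaps therefore yield gap 0 without the two inputs merging.
  Conversely a collision is approximated by rational inputs. The right-hand side uses only countable
  quantifiers.\<close>

lemma relu_layer_not_inj_iff_rational:
  fixes m n :: nat and W :: "nat \<times> nat \<Rightarrow> real"
  defines "Q \<equiv> ({..<n} \<rightarrow>\<^sub>E \<rat>) :: (nat \<Rightarrow> real) set"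
  shows "\<not> inj_on (relu_layer m n W) ({..<n} \<rightarrow>\<^sub>E (UNIV :: real set)) \<longleftrightarrow>
    (\<exists>k::nat. \<exists>j<n. \<forall>e::nat. \<exists>x\<in>Q. \<exists>y\<in>Q.
      ((\<forall>l<n. \<bar>x l\<bar> \<le> k \<and> \<bar>y l\<bar> \<le> k) \<and> \<bar>x j - y j\<bar> \<ge> 1 / Suc k) \<and>
      relu_gap m n W x y < 1 / Suc e)" (is "_ \<longleftrightarrow> ?R")
  unfolding relu_layer_not_inj_iff
proof
  assume "\<exists>x y. (\<exists>j<n. x j \<noteq> y j) \<and> relu_gap m n W x y = 0"
  then obtain x y j where xy: "j < n" "x j \<noteq> y j" "relu_gap m n W x y = 0" by auto
  have approx: "\<exists>X. \<forall>l. (\<forall>e. X l e \<in> \<rat>) \<and> X l \<longlonglongrightarrow> x l" for x :: "nat \<Rightarrow> real"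
    by (intro choice allI rational_sequence_tendsto)
  obtain X where X: "\<And>l e. X l e \<in> \<rat>" "\<And>l. X l \<longlonglongrightarrow> x l"
    using approx[of x] by auto
  obtain Y where Y: "\<And>l e. Y l e \<in> \<rat>" "\<And>l. Y l \<longlonglongrightarrow> y l"
    using approx[of y] by auto
  obtain k1 where k1: "1 / Suc k1 < \<bar>x j - y j\<bar>"
    using xy nat_approx_posE[of "\<bar>x j - y j\<bar>"] by auto
  obtain k2 :: nat where k2: "(\<Sum>l<n. \<bar>x l\<bar> + \<bar>y l\<bar>) < k2" using reals_Archimedean2 by blast
  define k where "k = max k1 k2"
  have le: "\<bar>x l\<bar> + \<bar>y l\<bar> < k" if "l < n" for l
  proof -
    have "\<bar>x l\<bar> + \<bar>y l\<bar> \<le> (\<Sum>l<n. \<bar>x l\<bar> + \<bar>y l\<bar>)"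
      using that by (intro member_le_sum) auto
    then show ?thesis using k2 by (simp add: k_def)
  qed
  have "1 / Suc k \<le> 1 / Suc k1" by (simp add: k_def field_simps)
  with k1 have k3: "1 / Suc k < \<bar>x j - y j\<bar>" by simp
  have evX: "\<forall>\<^sub>F e in sequentially. \<forall>l\<in>{..<n}. \<bar>X l e\<bar> < k"
  proof (intro eventually_ball_finite ballI)
    fix l assume "l \<in> {..<n}"
    then show "\<forall>\<^sub>F e in sequentially. \<bar>X l e\<bar> < k"
      using le[of l] by (intro order_tendstoD(2)[OF tendsto_rabs[OF X(2)]]) auto
  qed auto
  have evY: "\<forall>\<^sub>F e in sequentially. \<forall>l\<in>{..<n}. \<bar>Y l e\<bar> < k"
  proof (intro eventually_ball_finite ballI)
    fix l assume "l \<in> {..<n}"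
    then show "\<forall>\<^sub>F e in sequentially. \<bar>Y l e\<bar> < k"
      using le[of l] by (intro order_tendstoD(2)[OF tendsto_rabs[OF Y(2)]]) auto
  qed auto
  have evd: "\<forall>\<^sub>F e in sequentially. \<bar>X j e - Y j e\<bar> > 1 / Suc k"
    by (intro order_tendstoD(1)[OF tendsto_rabs[OF tendsto_diff[OF X(2) Y(2)]]] k3)
  have lim: "(\<lambda>e. relu_gap m n W (\<lambda>l. X l e) (\<lambda>l. Y l e)) \<longlonglongrightarrow> relu_gap m n W x y"
    unfolding relu_gap_def by (intro tendsto_intros X Y)
  show ?R
  proof (rule exI[of _ k], rule exI[of _ j], intro conjI allI xy)
    fix e :: nat
    have "\<forall>\<^sub>F i in sequentially. relu_gap m n W (\<lambda>l. X l i) (\<lambda>l. Y l i) < 1 / Suc e"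
      by (intro order_tendstoD(2)[OF lim]) (simp add: xy)
    with evX evY evd have "\<forall>\<^sub>F i in sequentially. relu_gap m n W (\<lambda>l. X l i) (\<lambda>l. Y l i) < 1 / Suc e
      \<and> (\<forall>l\<in>{..<n}. \<bar>X l i\<bar> < k) \<and> (\<forall>l\<in>{..<n}. \<bar>Y l i\<bar> < k) \<and> \<bar>X j i - Y j i\<bar> > 1 / Suc k"
      by eventually_elim auto
    then obtain i where i: "relu_gap m n W (\<lambda>l. X l i) (\<lambda>l. Y l i) < 1 / Suc e"
      "\<forall>l\<in>{..<n}. \<bar>X l i\<bar> < k" "\<forall>l\<in>{..<n}. \<bar>Y l i\<bar> < k" "\<bar>X j i - Y j i\<bar> > 1 / Suc k"
      using eventually_happens'[OF sequentially_bot] by blast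
    have "relu_gap m n W (\<lambda>l\<in>{..<n}. X l i) (\<lambda>l\<in>{..<n}. Y l i) < 1 / Suc e"
      using i(1) by (subst relu_gap_cong[where x'="\<lambda>l. X l i" and y'="\<lambda>l. Y l i"]) auto
    then show "\<exists>x\<in>Q. \<exists>y\<in>Q. ((\<forall>l<n. \<bar>x l\<bar> \<le> k \<and> \<bar>y l\<bar> \<le> k) \<and> \<bar>x j - y j\<bar> \<ge> 1 / Suc k) \<and>
      relu_gap m n W x y < 1 / Suc e"
      using i xy(1) X Y
      by (intro bexI[of _ "\<lambda>l\<in>{..<n}. X l i"] bexI[of _ "\<lambda>l\<in>{..<n}. Y l i"])
        (auto simp: Q_def less_imp_le)
  qed
next
  assume ?R
  then obtain k j where j: "j < n" and R: "\<And>e::nat. \<exists>x\<in>Q. \<exists>y\<in>Q.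
      ((\<forall>l<n. \<bar>x l\<bar> \<le> real k \<and> \<bar>y l\<bar> \<le> real k) \<and> \<bar>x j - y j\<bar> \<ge> 1 / Suc k) \<and>
      relu_gap m n W x y < 1 / Suc e" by blast
  define B where "B = {x :: nat \<Rightarrow> real. \<forall>l. \<bar>x l\<bar> \<le> k}"
  define K where "K = (B \<times> B) \<inter> {p. 1 / Suc k \<le> \<bar>fst p j - snd p j\<bar>}"
  have cf: "continuous_on UNIV (\<lambda>p::(nat\<Rightarrow>real)\<times>(nat\<Rightarrow>real). fst p l)" for l
    by (rule continuous_on_product_then_coordinatewise) (intro continuous_intros)
  have cs: "continuous_on UNIV (\<lambda>p::(nat\<Rightarrow>real)\<times>(nat\<Rightarrow>real). snd p l)" for l
    by (rule continuous_on_product_then_coordinatewise) (intro continuous_intros)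
  have K: "compact K" unfolding K_def
    by (intro compact_Int_closed compact_Times closed_Collect_le continuous_intros cf cs)
      (auto simp: B_def compact_bounded_functions)
  have cont: "continuous_on UNIV (\<lambda>p. relu_gap m n W (fst p) (snd p))"
    unfolding relu_gap_def by (intro continuous_intros cf cs)
  have ex: "\<exists>p\<in>K. relu_gap m n W (fst p) (snd p) < 1 / Suc e" for e
  proof -
    obtain x y where xy: "(\<forall>l<n. \<bar>x l\<bar> \<le> real k \<and> \<bar>y l\<bar> \<le> real k)" "\<bar>x j - y j\<bar> \<ge> 1 / Suc k"
      "relu_gap m n W x y < 1 / Suc e" using R[of e] by blast
    \<comment> \<open>Members of \<open>Q\<close> equal \<open>undefined\<close> from
      \<open>n\<close> on, which need not respect the bound; \<open>B\<close> bounds every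
      coordinate, so these values are reset to 0.\<close>
    define x' where "x' = (\<lambda>l. if l < n then x l else 0)"
    define y' where "y' = (\<lambda>l. if l < n then y l else 0)"
    have "relu_gap m n W x' y' = relu_gap m n W x y"
      by (rule relu_gap_cong) (auto simp: x'_def y'_def)
    moreover have "(x', y') \<in> K" using xy j by (auto simp: x'_def y'_def K_def B_def)
    ultimately show ?thesis using xy by (intro bexI[of _ "(x', y')"]) auto
  qed
  then have "K \<noteq> {}" by auto
  from continuous_attains_inf[OF K this continuous_on_subset[OF cont]]
  obtain p where p: "p \<in> K"
    "\<And>q. q \<in> K \<Longrightarrow> relu_gap m n W (fst p) (snd p) \<le> relu_gap m n W (fst q) (snd q)" by auto
  have "relu_gap m n W (fst p) (snd p) < 1 / Suc e" for e
    using ex[of e] p(2) by force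
  then have "\<not> relu_gap m n W (fst p) (snd p) > 0"
    using nat_approx_posE by (metis less_asym)
  then have "relu_gap m n W (fst p) (snd p) = 0" using relu_gap_nonneg[of m n W "fst p" "snd p"] by simp
  moreover have "fst p j \<noteq> snd p j"
  proof
    assume "fst p j = snd p j"
    with p(1) have "1 / Suc k \<le> (0::real)" by (simp add: K_def)
    then show False by (simp add: field_simps)
  qed
  ultimately show "\<exists>x y. (\<exists>j<n. x j \<noteq> y j) \<and> relu_gap m n W x y = 0" using j by blast
qed

lemma sets_gauss_matrix [measurable_cong]:
  "sets (gauss_matrix m n) = sets (PiM ({..<m} \<times> {..<n}) (\<lambda>_. borel))"
  unfolding gauss_matrix_def by (intro sets_PiM_cong) auto

text \<open>Outside the index set an entry is the constant \<open>undefined\<close> on the whole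
  space, so no index condition burdens later measurability goals.\<close>

lemma measurable_gauss_matrix_entry [measurable]:
  "(\<lambda>W. W p) \<in> borel_measurable (gauss_matrix m n)"
proof (cases "p \<in> {..<m} \<times> {..<n}")
  case True
  then show ?thesis
    unfolding measurable_cong_sets[OF sets_gauss_matrix refl] by (rule measurable_component_singleton)
next
  case False
  then have "W p = undefined" if "W \<in> space (gauss_matrix m n)" for W
    using that by (cases p) (auto simp: gauss_matrix_def space_PiM PiE_def extensional_def)
  then show ?thesis by (subst measurable_cong[where g="\<lambda>_. undefined"]) auto
qed

text \<open>By compactness non-injectivity is a countable condition on rational inputs; without
  measurability the measure of this set would be the junk value 0.\<close>
lemma sets_relu_layer_not_inj:
  "{W \<in> space (gauss_matrix m n). \<not> inj_on (relu_layer m n W) ({..<n} \<rightarrow>\<^sub>E (UNIV :: real set))}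
    \<in> sets (gauss_matrix m n)"
proof -
  define Q where "Q = ({..<n} \<rightarrow>\<^sub>E (\<rat>::real set))"
  have Q: "countable Q" unfolding Q_def by (intro countable_PiE) (auto simp: countable_rat)
  have [measurable]: "(\<lambda>W. relu_gap m n W x y) \<in> borel_measurable (gauss_matrix m n)" for x y
    unfolding relu_gap_def by measurable
  show ?thesis
    unfolding relu_layer_not_inj_iff_rational Q_def[symmetric]
    by (intro sets.sets_Collect_countable_Ex sets.sets_Collect_countable_All
        sets.sets_Collect_countable_Ex' sets.sets_Collect_conj sets.sets_Collect_const Q) measurable
qed

section \<open>Joint weak convergence from joint characteristic functions\<close>

lemma (in prob_space) integrable_bounded_times_iexp:
  fixes w Z :: "'a \<Rightarrow> real"
  assumes [measurable]: "w \<in> borel_measurable M" "Z \<in> borel_measurable M"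
    and "\<And>x. \<bar>w x\<bar> \<le> B"
  shows "integrable M (\<lambda>x. w x * iexp (Z x))"
  by (rule integrable_const_bound[where B=B]) (auto simp: assms norm_mult)

text \<open>Levy's theorem concerns probability laws, so \<open>w n\<close> is normalised to a
  density and \<open>Z n\<close> is studied under the tilted measure. The lower bound 1 keeps the
  normalising constants away from 0, so that their limit \<open>\<kappa>\<close> can be divided
  out.\<close>

lemma weighted_levy_continuity:
  fixes P :: "nat \<Rightarrow> 'a measure" and w Z :: "nat \<Rightarrow> 'a \<Rightarrow> real"
  assumes prob: "\<And>n. prob_space (P n)"
    and [measurable]: "\<And>n. w n \<in> borel_measurable (P n)" "\<And>n. Z n \<in> borel_measurable (P n)"
    and w: "\<And>n x. 1 \<le> w n x" "\<And>n x. w n x \<le> B"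
    and nu: "real_distribution \<nu>" "isCont (cdf \<nu>) y"
    and lim: "\<And>t. (\<lambda>n. CLINT x|P n. w n x * iexp (t * Z n x)) \<longlonglongrightarrow> \<kappa> * char \<nu> t"
  shows "(\<lambda>n. LINT x|P n. w n x * indicator {..y} (Z n x)) \<longlonglongrightarrow> \<kappa> * cdf \<nu> y"
proof -
  interpret P: prob_space "P n" for n by (rule prob)
  interpret nu: real_distribution \<nu> by (rule nu)
  have w0: "0 \<le> w n x" for n x using w(1)[of n x] by simp
  have int_w: "integrable (P n) (w n)" for n
    by (rule P.integrable_const_bound[where B=B]) (use w w0 in auto)
  define E where "E n = (LINT x|P n. w n x)" for n
  have E1: "E n \<ge> 1" for n
    using integral_mono[OF _ int_w, of n "\<lambda>_. 1"] w by (simp add: E_def P.prob_space)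
  \<comment> \<open>Frequency 0 identifies \<open>\<kappa>\<close> as the limit of the total
    weights.\<close>
  have limE: "E \<longlonglongrightarrow> \<kappa>"
  proof -
    have "(\<lambda>n. complex_of_real (E n)) \<longlonglongrightarrow> complex_of_real \<kappa>"
      using lim[of 0] by (simp add: nu.char_zero E_def)
    then show ?thesis by (simp add: tendsto_of_real_iff)
  qed
  have "\<kappa> \<ge> 1" by (rule LIMSEQ_le_const[OF limE]) (use E1 in auto)
  define D where "D n = density (P n) (\<lambda>x. w n x / E n)" for n
  have [measurable_cong]: "sets (D n) = sets (P n)" for n by (simp add: D_def)
  define M where "M n = distr (D n) borel (Z n)" for n
  have nonneg: "0 \<le> w n x / E n" for n x using w0 E1[of n] by simp
  have D: "prob_space (D n)" for n
  proof
    have "emeasure (D n) (space (D n)) = (\<integral>\<^sup>+x. ennreal (w n x / E n) \<partial>P n)"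
      by (simp add: D_def emeasure_density cong: nn_integral_cong)
    also have "\<dots> = ennreal (LINT x|P n. w n x / E n)"
      using w0 E1[of n] int_w by (intro nn_integral_eq_integral) auto
    also have "(LINT x|P n. w n x / E n) = 1" using E1[of n] by (simp add: E_def)
    finally show "emeasure (D n) (space (D n)) = 1" by simp
  qed
  have M: "real_distribution (M n)" for n
    unfolding real_distribution_def real_distribution_axioms_def M_def
    by (auto intro!: prob_space.prob_space_distr[OF D])
  have "(\<lambda>n. char (M n) t) \<longlonglongrightarrow> char \<nu> t" for t
  proof -
    have "char (M n) t = (CLINT x|P n. w n x * iexp (t * Z n x)) / E n" for n
    proof -
      have "char (M n) t = (CLINT x|D n. iexp (t * Z n x))"
        unfolding char_def M_def by (subst integral_distr) auto
      also have "\<dots> = (CLINT x|P n. (w n x * iexp (t * Z n x)) / E n)"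
        unfolding D_def by (subst integral_density) (auto simp: scaleR_conv_of_real nonneg)
      finally show ?thesis by simp
    qed
    moreover have "(\<lambda>n. (CLINT x|P n. w n x * iexp (t * Z n x)) / E n) \<longlonglongrightarrow> \<kappa> * char \<nu> t / \<kappa>"
      using \<open>\<kappa> \<ge> 1\<close> by (intro tendsto_divide lim tendsto_of_real limE) auto
    ultimately show ?thesis using \<open>\<kappa> \<ge> 1\<close> by simp
  qed
  then have "weak_conv_m M \<nu>" by (intro levy_continuity M nu)
  then have "(\<lambda>n. cdf (M n) y) \<longlonglongrightarrow> cdf \<nu> y"
    using nu(2) by (simp add: weak_conv_m_def weak_conv_def)
  then have "(\<lambda>n. E n * cdf (M n) y) \<longlonglongrightarrow> \<kappa> * cdf \<nu> y" by (intro tendsto_mult limE)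
  moreover have "E n * cdf (M n) y = (LINT x|P n. w n x * indicator {..y} (Z n x))" for n
  proof -
    have "cdf (M n) y = (LINT x|M n. indicator {..y} x)"
      by (simp add: cdf_def M_def)
    also have "\<dots> = (LINT x|D n. indicator {..y} (Z n x))"
      unfolding M_def by (subst integral_distr) auto
    also have "\<dots> = (LINT x|P n. (w n x * indicator {..y} (Z n x)) / E n)"
      unfolding D_def by (subst integral_density) (auto simp: nonneg)
    finally show ?thesis using E1[of n] by simp
  qed
  ultimately show ?thesis by simp
qed

text \<open>For fixed \<open>s\<close>, the factor \<open>iexp (s * X)\<close> acts as a weight on
  the law of \<open>Z\<close>, but a density must be real and positive. Its real and imaginary parts
  are therefore replaced by cosines raised by 2. This turns the frequency of \<open>Z\<close> into
  the event \<open>Z \<le> y\<close>; a second pass with that event as the weight treats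
  \<open>X\<close>.\<close>

lemma joint_levy_continuity:
  fixes P :: "nat \<Rightarrow> 'a measure" and X Z :: "nat \<Rightarrow> 'a \<Rightarrow> real"
  assumes prob: "\<And>n. prob_space (P n)"
    and [measurable]: "\<And>n. X n \<in> borel_measurable (P n)" "\<And>n. Z n \<in> borel_measurable (P n)"
    and mu: "real_distribution \<mu>" "isCont (cdf \<mu>) x"
    and nu: "real_distribution \<nu>" "isCont (cdf \<nu>) y"
    and lim: "\<And>s t. (\<lambda>n. CLINT \<omega>|P n. iexp (s * X n \<omega> + t * Z n \<omega>)) \<longlonglongrightarrow> char \<mu> s * char \<nu> t"
  shows "(\<lambda>n. LINT \<omega>|P n. indicator {..x} (X n \<omega>) * indicator {..y} (Z n \<omega>) :: real)
      \<longlonglongrightarrow> cdf \<mu> x * cdf \<nu> y" (is ?joint)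
    and "(\<lambda>n. LINT \<omega>|P n. indicator {..x} (X n \<omega>) :: real) \<longlonglongrightarrow> cdf \<mu> x" (is ?marginal_X)
    and "(\<lambda>n. LINT \<omega>|P n. indicator {..y} (Z n \<omega>) :: real) \<longlonglongrightarrow> cdf \<nu> y" (is ?marginal_Z)
proof -
  interpret P: prob_space "P n" for n by (rule prob)
  interpret mu: real_distribution \<mu> by (rule mu)
  interpret nu: real_distribution \<nu> by (rule nu)
  have int_iexp: "integrable (P n) (\<lambda>\<omega>. iexp (f \<omega>))" if "f \<in> borel_measurable (P n)" for f n
    using that by (intro P.integrable_iexp) auto
  have int_ind: "integrable (P n) (\<lambda>\<omega>. f \<omega> * indicator {..a} (g \<omega>))"
    if [measurable]: "f \<in> borel_measurable (P n)" "g \<in> borel_measurable (P n)"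
      and "\<And>\<omega>. \<bar>f \<omega>\<bar> \<le> 1" for n a and f g :: "'a \<Rightarrow> real"
    by (rule P.integrable_const_bound[where B=1]) (use that in \<open>auto simp: indicator_def abs_mult\<close>)
  show mX: ?marginal_X
    using weighted_levy_continuity[of P "\<lambda>_ _. 1" X 1 \<mu> x 1] lim[of _ 0] prob mu
    by (simp add: nu.char_zero)
  show mZ: ?marginal_Z
    using weighted_levy_continuity[of P "\<lambda>_ _. 1" Z 1 \<nu> y 1] lim[of 0] prob nu
    by (simp add: mu.char_zero)
  have int_mu: "integrable \<mu> (\<lambda>x. iexp (s * x))" "integrable \<mu> (\<lambda>x. cos (s * x))"
      "integrable \<mu> (\<lambda>x. sin (s * x))" for s
    by (auto intro!: mu.integrable_iexp mu.integrable_const_bound[where B=1])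
  \<comment> \<open>The phase covers cosine and sine together: \<open>\<phi>\<close> is later taken
    as 0 and as \<open>- (pi / 2)\<close>.\<close>
  have cos_part: "(\<lambda>n. LINT \<omega>|P n. cos (s * X n \<omega> + \<phi>) * indicator {..y} (Z n \<omega>))
      \<longlonglongrightarrow> (LINT x|\<mu>. cos (s * x + \<phi>)) * cdf \<nu> y" for s \<phi>
  proof -
    define C where "C = (LINT x|\<mu>. cos (s * x + \<phi>))"
    have C: "complex_of_real C = (iexp \<phi> * char \<mu> s + iexp (-\<phi>) * char \<mu> (-s)) / 2"
    proof -
      have "complex_of_real C = (CLINT x|\<mu>. complex_of_real (cos (s * x + \<phi>)))"
        unfolding C_def by (rule integral_complex_of_real[symmetric])
      also have "\<dots> = (CLINT x|\<mu>. (iexp \<phi> * iexp (s * x) + iexp (-\<phi>) * iexp ((-s) * x)) / 2)"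
        by (intro Bochner_Integration.integral_cong refl)
          (simp add: cos_exp_eq cos_of_real[symmetric] exp_add[symmetric] algebra_simps del: cos_of_real)
      also have "\<dots> = (iexp \<phi> * char \<mu> s + iexp (-\<phi>) * char \<mu> (-s)) / 2"
        unfolding char_def using int_mu(1)[of s] int_mu(1)[of "-s"] by simp
      finally show ?thesis .
    qed
    \<comment> \<open>By Euler's formula the tilted expectation combines the joint characteristic
      functions at (0, t), (s, t) and (-s, t), whose limits share the factor
      \<open>char \<nu> t\<close>. The summand 2 is removed afterwards by means of the marginal
      limit \<open>mZ\<close>.\<close>
    have "(\<lambda>n. LINT \<omega>|P n. (2 + cos (s * X n \<omega> + \<phi>)) * indicator {..y} (Z n \<omega>)) \<longlonglongrightarrow> (2 + C) * cdf \<nu> y"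
    proof (rule weighted_levy_continuity[where B=3])
      fix t
      have "(CLINT \<omega>|P n. (2 + cos (s * X n \<omega> + \<phi>)) * iexp (t * Z n \<omega>)) =
          2 * (CLINT \<omega>|P n. iexp (0 * X n \<omega> + t * Z n \<omega>)) +
          (iexp \<phi> * (CLINT \<omega>|P n. iexp (s * X n \<omega> + t * Z n \<omega>)) +
           iexp (-\<phi>) * (CLINT \<omega>|P n. iexp ((-s) * X n \<omega> + t * Z n \<omega>))) / 2" for n
      proof -
        have "(CLINT \<omega>|P n. (2 + cos (s * X n \<omega> + \<phi>)) * iexp (t * Z n \<omega>)) =
          (CLINT \<omega>|P n. 2 * iexp (0 * X n \<omega> + t * Z n \<omega>) +
            (iexp \<phi> * iexp (s * X n \<omega> + t * Z n \<omega>) + iexp (-\<phi>) * iexp ((-s) * X n \<omega> + t * Z n \<omega>)) / 2)"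
          by (intro Bochner_Integration.integral_cong refl)
            (simp add: cos_exp_eq cos_of_real[symmetric] exp_add[symmetric] field_simps del: cos_of_real)
        also have "\<dots> = (CLINT \<omega>|P n. 2 * iexp (0 * X n \<omega> + t * Z n \<omega>)) +
            (CLINT \<omega>|P n. (iexp \<phi> * iexp (s * X n \<omega> + t * Z n \<omega>) + iexp (-\<phi>) * iexp ((-s) * X n \<omega> + t * Z n \<omega>)) / 2)"
          by (intro Bochner_Integration.integral_add integrable_mult_right
              integrable_divide_zero Bochner_Integration.integrable_add int_iexp) measurable
        also have "\<dots> = 2 * (CLINT \<omega>|P n. iexp (0 * X n \<omega> + t * Z n \<omega>)) +
          (iexp \<phi> * (CLINT \<omega>|P n. iexp (s * X n \<omega> + t * Z n \<omega>)) +
           iexp (-\<phi>) * (CLINT \<omega>|P n. iexp ((-s) * X n \<omega> + t * Z n \<omega>))) / 2"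
          by (simp only: integral_mult_right_zero integral_divide_zero, subst Bochner_Integration.integral_add[OF integrable_mult_right[OF int_iexp] integrable_mult_right[OF int_iexp]])
            (simp_all only: integral_mult_right_zero, measurable)
        finally show ?thesis .
      qed
      moreover have "(\<lambda>n. 2 * (CLINT \<omega>|P n. iexp (0 * X n \<omega> + t * Z n \<omega>)) +
          (iexp \<phi> * (CLINT \<omega>|P n. iexp (s * X n \<omega> + t * Z n \<omega>)) +
           iexp (-\<phi>) * (CLINT \<omega>|P n. iexp ((-s) * X n \<omega> + t * Z n \<omega>))) / 2) \<longlonglongrightarrow>
          2 * (char \<mu> 0 * char \<nu> t) + (iexp \<phi> * (char \<mu> s * char \<nu> t) + iexp (-\<phi>) * (char \<mu> (-s) * char \<nu> t)) / 2"
        by (intro tendsto_add tendsto_mult[OF tendsto_const] tendsto_divide[OF _ tendsto_const] lim) simp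
      moreover have "2 * (char \<mu> 0 * char \<nu> t) + (iexp \<phi> * (char \<mu> s * char \<nu> t) + iexp (-\<phi>) * (char \<mu> (-s) * char \<nu> t)) / 2 =
          complex_of_real (2 + C) * char \<nu> t"
        by (simp add: C mu.char_zero field_simps)
      ultimately show "(\<lambda>n. CLINT \<omega>|P n. (2 + cos (s * X n \<omega> + \<phi>)) * iexp (t * Z n \<omega>))
          \<longlonglongrightarrow> complex_of_real (2 + C) * char \<nu> t" by simp
    next
      fix n \<omega>
      have "-1 \<le> cos (s * X n \<omega> + \<phi>)" "cos (s * X n \<omega> + \<phi>) \<le> 1" by auto
      then show "1 \<le> 2 + cos (s * X n \<omega> + \<phi>)" "2 + cos (s * X n \<omega> + \<phi>) \<le> 3" by linarith+
    qed (use prob nu in auto)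
    moreover have "(LINT \<omega>|P n. (2 + cos (s * X n \<omega> + \<phi>)) * indicator {..y} (Z n \<omega>)) =
        2 * (LINT \<omega>|P n. indicator {..y} (Z n \<omega>)) +
        (LINT \<omega>|P n. cos (s * X n \<omega> + \<phi>) * indicator {..y} (Z n \<omega>))" for n
      unfolding distrib_right
      using int_ind[of "\<lambda>_. 1" n "Z n" y] int_ind[of "\<lambda>\<omega>. cos (s * X n \<omega> + \<phi>)" n "Z n" y]
      by (subst Bochner_Integration.integral_add) auto
    ultimately have "(\<lambda>n. (LINT \<omega>|P n. cos (s * X n \<omega> + \<phi>) * indicator {..y} (Z n \<omega>)) +
        2 * (LINT \<omega>|P n. indicator {..y} (Z n \<omega>)) - 2 * (LINT \<omega>|P n. indicator {..y} (Z n \<omega>)))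
        \<longlonglongrightarrow> (2 + C) * cdf \<nu> y - 2 * cdf \<nu> y"
      by (intro tendsto_diff tendsto_mult[OF tendsto_const] mZ) (simp add: add.commute)
    then show ?thesis by (simp add: C_def algebra_simps)
  qed
  have sin_part: "(\<lambda>n. LINT \<omega>|P n. sin (s * X n \<omega>) * indicator {..y} (Z n \<omega>))
      \<longlonglongrightarrow> (LINT x|\<mu>. sin (s * x)) * cdf \<nu> y" for s
  proof -
    have "sin a = cos (a + - (pi / 2))" for a :: real by (simp add: cos_diff)
    then show ?thesis using cos_part[of s "- (pi / 2)"] by simp
  qed
  have char_part: "(\<lambda>n. CLINT \<omega>|P n. complex_of_real (indicator {..y} (Z n \<omega>)) * iexp (s * X n \<omega>))
      \<longlonglongrightarrow> cdf \<nu> y * char \<mu> s" for s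
  proof -
    have *: "char \<mu> s = complex_of_real (LINT x|\<mu>. cos (s * x)) + \<i> * complex_of_real (LINT x|\<mu>. sin (s * x))"
    proof -
      have "char \<mu> s = (CLINT x|\<mu>. complex_of_real (cos (s * x)) + \<i> * complex_of_real (sin (s * x)))"
        unfolding char_def
        by (intro Bochner_Integration.integral_cong refl)
          (simp add: cis_conv_exp[symmetric] complex_eq_iff flip: of_real_mult)
      also have "\<dots> = complex_of_real (LINT x|\<mu>. cos (s * x)) + \<i> * complex_of_real (LINT x|\<mu>. sin (s * x))"
        using int_mu(2,3)[of s] by (subst Bochner_Integration.integral_add) auto
      finally show ?thesis .
    qed
    have **: "(CLINT \<omega>|P n. complex_of_real (indicator {..y} (Z n \<omega>)) * iexp (s * X n \<omega>)) =
        complex_of_real (LINT \<omega>|P n. cos (s * X n \<omega>) * indicator {..y} (Z n \<omega>)) +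
        \<i> * complex_of_real (LINT \<omega>|P n. sin (s * X n \<omega>) * indicator {..y} (Z n \<omega>))" for n
    proof -
      have "(CLINT \<omega>|P n. complex_of_real (indicator {..y} (Z n \<omega>)) * iexp (s * X n \<omega>)) =
          (CLINT \<omega>|P n. complex_of_real (cos (s * X n \<omega>) * indicator {..y} (Z n \<omega>)) +
            \<i> * complex_of_real (sin (s * X n \<omega>) * indicator {..y} (Z n \<omega>)))"
        by (intro Bochner_Integration.integral_cong refl)
          (auto simp: cis_conv_exp[symmetric] complex_eq_iff indicator_def simp flip: of_real_mult)
      also have "\<dots> = complex_of_real (LINT \<omega>|P n. cos (s * X n \<omega>) * indicator {..y} (Z n \<omega>)) +
        \<i> * complex_of_real (LINT \<omega>|P n. sin (s * X n \<omega>) * indicator {..y} (Z n \<omega>))"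
        using int_ind[of "\<lambda>\<omega>. cos (s * X n \<omega>)" n "Z n" y] int_ind[of "\<lambda>\<omega>. sin (s * X n \<omega>)" n "Z n" y]
        by (subst Bochner_Integration.integral_add)
          (auto simp del: of_real_mult intro!: integrable_mult_right integrable_of_real)
      finally show ?thesis .
    qed
    have "(\<lambda>n. complex_of_real (LINT \<omega>|P n. cos (s * X n \<omega>) * indicator {..y} (Z n \<omega>)) +
        \<i> * complex_of_real (LINT \<omega>|P n. sin (s * X n \<omega>) * indicator {..y} (Z n \<omega>))) \<longlonglongrightarrow>
        complex_of_real ((LINT x|\<mu>. cos (s * x)) * cdf \<nu> y) + \<i> * complex_of_real ((LINT x|\<mu>. sin (s * x)) * cdf \<nu> y)"
      by (intro tendsto_intros cos_part[of _ 0, simplified] sin_part)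
    then show ?thesis unfolding ** * by (simp add: algebra_simps)
  qed
  \<comment> \<open>Second pass with the roles exchanged: the indicator of the event in
    \<open>Z\<close>, raised by 1 to stay bounded below, is the weight, and \<open>X\<close> carries
    the frequency.\<close>
  have "(\<lambda>n. LINT \<omega>|P n. (1 + indicator {..y} (Z n \<omega>)) * indicator {..x} (X n \<omega>))
      \<longlonglongrightarrow> (1 + cdf \<nu> y) * cdf \<mu> x"
  proof (rule weighted_levy_continuity[where B=2])
    fix s
    have "(CLINT \<omega>|P n. complex_of_real (1 + indicator {..y} (Z n \<omega>)) * iexp (s * X n \<omega>)) =
        (CLINT \<omega>|P n. iexp (s * X n \<omega> + 0 * Z n \<omega>)) +
        (CLINT \<omega>|P n. complex_of_real (indicator {..y} (Z n \<omega>)) * iexp (s * X n \<omega>))" for n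
      unfolding of_real_add distrib_right
      by (subst Bochner_Integration.integral_add)
        (auto intro!: int_iexp P.integrable_bounded_times_iexp[where B=1] simp: indicator_def simp del: of_real_mult)
    moreover have "(\<lambda>n. (CLINT \<omega>|P n. iexp (s * X n \<omega> + 0 * Z n \<omega>)) +
        (CLINT \<omega>|P n. complex_of_real (indicator {..y} (Z n \<omega>)) * iexp (s * X n \<omega>)))
        \<longlonglongrightarrow> char \<mu> s * char \<nu> 0 + cdf \<nu> y * char \<mu> s"
      by (intro tendsto_add lim char_part)
    ultimately show "(\<lambda>n. CLINT \<omega>|P n. complex_of_real (1 + indicator {..y} (Z n \<omega>)) * iexp (s * X n \<omega>))
        \<longlonglongrightarrow> complex_of_real (1 + cdf \<nu> y) * char \<mu> s"
      by (simp add: nu.char_zero algebra_simps)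
  qed (use prob mu in \<open>auto simp: indicator_def\<close>)
  moreover have "(LINT \<omega>|P n. (1 + indicator {..y} (Z n \<omega>)) * indicator {..x} (X n \<omega>)) =
      (LINT \<omega>|P n. indicator {..x} (X n \<omega>)) +
      (LINT \<omega>|P n. indicator {..x} (X n \<omega>) * indicator {..y} (Z n \<omega>) :: real)" for n
    unfolding distrib_right
    using int_ind[of "\<lambda>_. 1" n "X n" x] int_ind[of "\<lambda>\<omega>. indicator {..y} (Z n \<omega>)" n "X n" x]
    by (subst Bochner_Integration.integral_add) (auto simp: mult.commute indicator_def)
  ultimately have "(\<lambda>n. (LINT \<omega>|P n. indicator {..x} (X n \<omega>)) +
      (LINT \<omega>|P n. indicator {..x} (X n \<omega>) * indicator {..y} (Z n \<omega>) :: real) -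
      (LINT \<omega>|P n. indicator {..x} (X n \<omega>))) \<longlonglongrightarrow> (1 + cdf \<nu> y) * cdf \<mu> x - cdf \<mu> x"
    by (intro tendsto_diff mX) simp
  then show ?joint by (simp add: algebra_simps)
qed

section \<open>The critical ratio\<close>

text \<open>The substitution \<open>x = - sqrt 2 * t\<close> carries the lower normal tail to the
  integral of \<open>exp (- t\<^sup>2)\<close> over \<open>{z..}\<close>, which is the half-line
  integral \<open>sqrt pi / 2\<close> minus the part over \<open>{0..<z}\<close>.\<close>

lemma cdf_std_normal_eq_erfc:
  assumes "z \<ge> 0"
  shows "cdf std_normal_distribution (- (sqrt 2 * z)) = erfc z / 2"
proof -
  have int: "integrable lborel (\<lambda>t::real. indicator A t *\<^sub>R exp (- t\<^sup>2))" if "A \<subseteq> {0..}" "A \<in> sets borel" for A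
  proof -
    have "set_integrable lborel {0..} (\<lambda>t::real. exp (- t\<^sup>2))"
      using gaussian_moment_0 by (auto simp: set_integrable_def has_bochner_integral_iff)
    from set_integrable_subset[OF this, of A] show ?thesis
      using that by (simp add: set_integrable_def)
  qed
  have half: "(LINT t|lborel. indicator {0..} t *\<^sub>R exp (- t\<^sup>2)) = sqrt pi / 2"
    using gaussian_moment_0 by (simp add: has_bochner_integral_iff)
  have "cdf std_normal_distribution (- (sqrt 2 * z)) =
      (LINT x|std_normal_distribution. indicator {..- (sqrt 2 * z)} x)"
    by (simp add: cdf_def)
  also have "\<dots> = (LINT x|lborel. std_normal_density x * indicator {..- (sqrt 2 * z)} x)"
    by (subst integral_density) auto
  also have "\<dots> = \<bar>- sqrt 2\<bar> *\<^sub>R (LINT t|lborel. std_normal_density (0 + (- sqrt 2) * t) *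
      indicator {..- (sqrt 2 * z)} (0 + (- sqrt 2) * t))"
    by (rule lborel_integral_real_affine) simp
  also have "\<dots> = (LINT t|lborel. 1 / sqrt pi * (indicator {z..} t *\<^sub>R exp (- t\<^sup>2)))"
    unfolding integral_scaleR_right[symmetric]
    by (intro Bochner_Integration.integral_cong refl)
      (auto simp: std_normal_density_def indicator_def power_mult_distrib real_sqrt_mult)
  also have "\<dots> = 1 / sqrt pi * (LINT t|lborel. indicator {z..} t *\<^sub>R exp (- t\<^sup>2))"
    by simp
  also have "(LINT t|lborel. indicator {z..} t *\<^sub>R exp (- t\<^sup>2)) =
      sqrt pi / 2 - (LINT t|lborel. indicator {0..<z} t *\<^sub>R exp (- t\<^sup>2))"
  proof -
    have "(LINT t|lborel. indicator {0..} t *\<^sub>R exp (- t\<^sup>2)) =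
      (LINT t|lborel. indicator {z..} t *\<^sub>R exp (- t\<^sup>2) + indicator {0..<z} t *\<^sub>R exp (- t\<^sup>2))"
      using assms by (intro Bochner_Integration.integral_cong refl) (auto simp: indicator_def)
    also have "\<dots> = (LINT t|lborel. indicator {z..} t *\<^sub>R exp (- t\<^sup>2)) +
        (LINT t|lborel. indicator {0..<z} t *\<^sub>R exp (- t\<^sup>2))"
      using assms by (intro Bochner_Integration.integral_add int) auto
    finally show ?thesis using half by simp
  qed
  also have "(LINT t|lborel. indicator {0..<z} t *\<^sub>R exp (- t\<^sup>2)) = (LBINT t=0..z. exp (- (t\<^sup>2)))"
    using interval_integral_Ico[of 0 z "\<lambda>t. exp (- (t\<^sup>2))"] assms
    by (simp add: set_lebesgue_integral_def zero_ereal_def)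
  finally show ?thesis by (simp add: erfc_def right_diff_distrib diff_divide_distrib)
qed

lemma isCont_cdf_std_normal: "isCont (cdf std_normal_distribution) x"
proof -
  interpret real_distribution std_normal_distribution by (rule real_dist_normal_dist)
  have "emeasure std_normal_distribution {x} = 0"
    by (subst emeasure_density) (auto intro!: nn_integral_null_set)
  then show ?thesis by (simp add: isCont_cdf measure_def)
qed

lemma erfc_eq_cdf:
  assumes "c > 0"
  shows "erfc (1 / sqrt (2 * c)) / 2 = cdf std_normal_distribution (- (1 / sqrt c))"
proof -
  have "sqrt 2 * (1 / sqrt (2 * c)) = 1 / sqrt c" by (simp add: real_sqrt_mult)
  then show ?thesis using cdf_std_normal_eq_erfc[of "1 / sqrt (2 * c)"] assms by simp
qed

lemma cdf_std_normal_0: "cdf std_normal_distribution 0 = 1 / 2"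
  using cdf_std_normal_eq_erfc[of 0] by (simp add: erfc_def zero_ereal_def)

lemma cdf_std_normal_mono: "x \<le> y \<Longrightarrow> cdf std_normal_distribution x \<le> cdf std_normal_distribution y"
proof -
  interpret real_distribution std_normal_distribution by (rule real_dist_normal_dist)
  show "x \<le> y \<Longrightarrow> ?thesis" by (rule cdf_nondecreasing)
qed

text \<open>As the distribution function is monotone, lowering \<open>d\<close> to \<open>c\<close>
  cannot raise its value above \<open>1 / d\<close>, and the factor \<open>c\<close> is strictly
  smaller than \<open>d\<close>. This yields both the uniqueness of the critical ratio and the
  strict inequality below it.\<close>

lemma times_cdf_less_1_below_solution:
  assumes "0 < c" "c < d" "cdf std_normal_distribution (- (1 / sqrt d)) = 1 / d"
  shows "c * cdf std_normal_distribution (- (1 / sqrt c)) < 1"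
proof -
  have "cdf std_normal_distribution (- (1 / sqrt c)) \<le> cdf std_normal_distribution (- (1 / sqrt d))"
    using assms by (intro cdf_std_normal_mono) (simp add: frac_le)
  then have "c * cdf std_normal_distribution (- (1 / sqrt c)) \<le> c * (1 / d)"
    using assms by (intro mult_left_mono) auto
  also have "\<dots> < 1" using assms by simp
  finally show ?thesis .
qed

lemma c_star_ex: "\<exists>c>0. cdf std_normal_distribution (- (1 / sqrt c)) = 1 / c"
proof -
  interpret real_distribution std_normal_distribution by (rule real_dist_normal_dist)
  define h where "h c = c * cdf std_normal_distribution (- (1 / sqrt c))" for c
  \<comment> \<open>The intermediate value theorem is applied to \<open>h\<close> on
    \<open>{1..C}\<close>. At 1 the value is a probability. For large \<open>c\<close> the
    distribution function tends to 1/2 and so exceeds 1/4, whence \<open>c \<ge> 4\<close> gives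
    \<open>h c \<ge> 1\<close>.\<close>
  have "((\<lambda>c. cdf std_normal_distribution (- (1 / sqrt c))) \<longlongrightarrow> cdf std_normal_distribution (- 0)) at_top"
    by (intro isCont_tendsto_compose[OF isCont_cdf_std_normal] tendsto_minus
        tendsto_divide_0[OF tendsto_const] filterlim_at_top_imp_at_infinity sqrt_at_top)
  then have "\<forall>\<^sub>F c in at_top. cdf std_normal_distribution (- (1 / sqrt c)) > 1 / 4"
    by (intro order_tendstoD(1)) (auto simp: cdf_std_normal_0)
  moreover have "\<forall>\<^sub>F c in at_top. c \<ge> (4::real)" by (rule eventually_ge_at_top)
  ultimately have "\<forall>\<^sub>F c in at_top. c \<ge> 4 \<and> h c \<ge> 1"
  proof eventually_elim
    case (elim c)
    then have "4 * (1 / 4) \<le> h c" unfolding h_def by (intro mult_mono) auto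
    then show ?case using elim by simp
  qed
  then obtain C where C: "C \<ge> 4" "h C \<ge> 1" using eventually_happens'[OF trivial_limit_at_top_linorder] by blast
  have "h 1 \<le> 1" using cdf_bounded_prob[of "-1"] by (simp add: h_def)
  moreover have "continuous_on {1..C} h"
  proof -
    have cont: "continuous_on UNIV (cdf std_normal_distribution)"
      by (intro continuous_at_imp_continuous_on ballI isCont_cdf_std_normal)
    have "continuous_on {1..C} (\<lambda>c. cdf std_normal_distribution (- (1 / sqrt c)))"
      by (rule continuous_on_compose2[OF cont]) (auto intro!: continuous_intros)
    then show ?thesis unfolding h_def by (intro continuous_on_mult continuous_on_id)
  qed
  ultimately obtain c where "1 \<le> c" "h c = 1" using IVT'[of h 1 1 C] C by auto
  moreover from this have "cdf std_normal_distribution (- (1 / sqrt c)) = 1 / c"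
    by (simp add: h_def eq_divide_eq mult.commute)
  ultimately show ?thesis by (intro exI[of _ c]) auto
qed

text \<open>\<open>c_star\<close> is a definite description, so existence and uniqueness must be
  settled before its equation can be used.\<close>

lemma c_star_props: "c_star > 0" "cdf std_normal_distribution (- (1 / sqrt c_star)) = 1 / c_star"
proof -
  let ?P = "\<lambda>c. c > 0 \<and> erfc (1 / sqrt (2 * c)) / 2 = 1 / c"
  have P: "?P c \<longleftrightarrow> c > 0 \<and> cdf std_normal_distribution (- (1 / sqrt c)) = 1 / c" for c
    using erfc_eq_cdf[of c] by auto
  have "\<exists>!c. ?P c"
  proof (rule ex_ex1I)
    show "\<exists>c. ?P c" unfolding P using c_star_ex by auto
    fix c d assume cd: "?P c" "?P d"
    have "\<not> c < d" if cd: "?P c" "?P d" for c d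
    proof
      assume "c < d"
      have "c * cdf std_normal_distribution (- (1 / sqrt c)) < 1"
        by (rule times_cdf_less_1_below_solution[OF _ \<open>c < d\<close>]) (use cd P in blast)+
      moreover have "cdf std_normal_distribution (- (1 / sqrt c)) = 1 / c" using cd P by blast
      ultimately show False using cd by simp
    qed
    then show "c = d" using cd by (meson linorder_neqE_linordered_idom)
  qed
  from theI'[OF this] have "?P c_star" unfolding c_star_def .
  then show "c_star > 0" "cdf std_normal_distribution (- (1 / sqrt c_star)) = 1 / c_star" using P by auto
qed

section \<open>Joint characteristic function of two row scores\<close>

text \<open>Mean value inequality on the convex left half-plane, where the derivative of
  \<open>exp\<close> has norm at most 1. It supplies the dominating function for the column
  integrals.\<close>

lemma norm_exp_minus_1_le:
  assumes "Re z \<le> 0"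
  shows "norm (exp z - 1 :: complex) \<le> norm z"
proof -
  have "norm (exp z - exp 0) \<le> 1 * norm (z - 0)"
  proof (rule field_differentiable_bound[where S="{z. Re z \<le> 0}" and f'=exp])
    fix w :: complex assume "w \<in> {z. Re z \<le> 0}"
    then show "norm (exp w) \<le> 1" by simp
  qed (use assms in \<open>auto intro!: derivative_eq_intros simp: convex_halfspace_Re_le\<close>)
  then show ?thesis by simp
qed

lemma tendsto_n_times_exp_minus_1:
  fixes z :: "nat \<Rightarrow> complex"
  assumes "(\<lambda>n. of_nat n * z n) \<longlonglongrightarrow> l"
  shows "(\<lambda>n. of_nat n * (exp (z n) - 1)) \<longlonglongrightarrow> l"
proof -
  \<comment> \<open>The value 1 fills the removable singularity, so the product formula also holds
    at indices with \<open>z n = 0\<close>.\<close>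
  define g :: "complex \<Rightarrow> complex" where "g h = (if h = 0 then 1 else (exp h - 1) / h)" for h
  have "((\<lambda>h. (exp h - 1) / h) \<longlongrightarrow> 1) (at (0::complex))"
    using DERIV_exp[of "0::complex"] by (simp add: has_field_derivative_iff)
  then have "(g \<longlongrightarrow> 1) (at 0)"
    by (rule Lim_transform_eventually) (auto simp: eventually_at g_def intro!: exI[of _ 1])
  then have g: "isCont g 0" by (simp add: isCont_def g_def)
  have "(\<lambda>n. of_nat n * z n * inverse (of_nat n)) \<longlonglongrightarrow> l * 0"
    by (intro tendsto_mult assms lim_inverse_n)
  moreover have "\<forall>\<^sub>F n in sequentially. of_nat n * z n * inverse (of_nat n) = z n"
    using eventually_gt_at_top[of 0] by eventually_elim simp
  ultimately have "z \<longlonglongrightarrow> l * 0" by (rule Lim_transform_eventually)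
  then have "z \<longlonglongrightarrow> 0" by simp
  then have "(\<lambda>n. of_nat n * z n * g (z n)) \<longlonglongrightarrow> l * g 0"
    by (intro tendsto_mult assms isCont_tendsto_compose[OF g])
  moreover have "of_nat n * z n * g (z n) = of_nat n * (exp (z n) - 1)" for n
    by (simp add: g_def)
  moreover have "g 0 = 1" by (simp add: g_def)
  ultimately show ?thesis by simp
qed

text \<open>Complex logarithms are avoided by comparing \<open>a n\<close> with
  \<open>exp (z / n)\<close>, whose power is exact for \<open>n > 0\<close>. Both lie in the unit
  disc, where n-th powers differ by at most \<open>n\<close> times the difference of the
  bases.\<close>

lemma tendsto_power_exp:
  fixes a :: "nat \<Rightarrow> complex"
  assumes a: "\<And>n. norm (a n) \<le> 1" and z: "Re z \<le> 0"
    and lim: "(\<lambda>n. of_nat n * (a n - 1)) \<longlonglongrightarrow> z"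
  shows "(\<lambda>n. a n ^ n) \<longlonglongrightarrow> exp z"
proof -
  define b where "b n = exp (z / of_nat n)" for n
  have b1: "norm (b n) \<le> 1" for n
    using z by (simp add: b_def Re_divide_of_nat divide_nonpos_nonneg)
  have "(\<lambda>n. of_nat n * (z / of_nat n)) \<longlonglongrightarrow> z"
    by (rule Lim_transform_eventually[OF tendsto_const eventually_mono[OF eventually_gt_at_top[of 0]]]) auto
  then have "(\<lambda>n. of_nat n * (b n - 1)) \<longlonglongrightarrow> z"
    unfolding b_def by (rule tendsto_n_times_exp_minus_1)
  with lim have "(\<lambda>n. norm (of_nat n * (a n - 1) - of_nat n * (b n - 1))) \<longlonglongrightarrow> norm (z - z)"
    by (intro tendsto_intros)
  moreover have "norm (of_nat n * (a n - 1) - of_nat n * (b n - 1)) = real n * norm (a n - b n)" for n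
    by (simp add: right_diff_distrib[symmetric] norm_mult)
  ultimately have "(\<lambda>n. real n * norm (a n - b n)) \<longlonglongrightarrow> 0" by simp
  then have "(\<lambda>n. a n ^ n - b n ^ n) \<longlonglongrightarrow> 0"
    by (rule Lim_null_comparison[rotated]) (intro always_eventually allI norm_power_diff a b1)
  moreover have "(\<lambda>n. b n ^ n) \<longlonglongrightarrow> exp z"
    by (rule Lim_transform_eventually[OF tendsto_const eventually_mono[OF eventually_gt_at_top[of 0]]])
      (auto simp: b_def exp_of_nat_mult[symmetric])
  ultimately have "(\<lambda>n. (a n ^ n - b n ^ n) + b n ^ n) \<longlonglongrightarrow> 0 + exp z" by (rule tendsto_add)
  then show ?thesis by simp
qed

section \<open>Gaussian product measures\<close>

lemma prob_space_std_normal: "prob_space std_normal_distribution"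
  by (rule real_distribution.axioms(1)[OF real_dist_normal_dist])

interpretation std_normal: prob_space std_normal_distribution
  by (rule prob_space_std_normal)

interpretation std_normal_pair: pair_prob_space std_normal_distribution std_normal_distribution ..

interpretation std_normal_product: product_prob_space "\<lambda>_. std_normal_distribution" UNIV ..

lemma integral_iexp_std_normal:
  "(CLINT x|std_normal_distribution. iexp (t * x)) = exp (- (t\<^sup>2) / 2)"
  using char_std_normal_distribution by (auto simp: char_def fun_eq_iff)

lemma std_normal_pair_product:
  fixes f g :: "real \<Rightarrow> real"
  assumes f: "integrable std_normal_distribution f" and g: "integrable std_normal_distribution g"
  shows "integrable (std_normal_distribution \<Otimes>\<^sub>M std_normal_distribution) (\<lambda>p. f (fst p) * g (snd p))"
    and "(LINT p|(std_normal_distribution \<Otimes>\<^sub>M std_normal_distribution). f (fst p) * g (snd p)) =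
      (LINT x|std_normal_distribution. f x) * (LINT x|std_normal_distribution. g x)"
proof -
  have [measurable]: "f \<in> borel_measurable borel" "g \<in> borel_measurable borel"
    using borel_measurable_integrable[OF f] borel_measurable_integrable[OF g] by auto
  show *: "integrable (std_normal_distribution \<Otimes>\<^sub>M std_normal_distribution) (\<lambda>p. f (fst p) * g (snd p))"
    by (rule std_normal_pair.Fubini_integrable) (use f g in \<open>auto simp: abs_mult\<close>)
  show "(LINT p|(std_normal_distribution \<Otimes>\<^sub>M std_normal_distribution). f (fst p) * g (snd p)) =
      (LINT x|std_normal_distribution. f x) * (LINT x|std_normal_distribution. g x)"
    using std_normal_pair.integral_fst'[OF *] by simp
qed

lemma std_normal_pair_monomials:
  defines "N2 \<equiv> std_normal_distribution \<Otimes>\<^sub>M std_normal_distribution"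
  shows "integrable N2 (\<lambda>p. (fst p)\<^sup>2)" "integrable N2 (\<lambda>p. fst p * snd p)" "integrable N2 (\<lambda>p. (snd p)\<^sup>2)"
    and "(LINT p|N2. (fst p)\<^sup>2) = 1" "(LINT p|N2. fst p * snd p) = 0" "(LINT p|N2. (snd p)\<^sup>2) = 1"
proof -
  have i: "integrable std_normal_distribution (\<lambda>x. x)" "integrable std_normal_distribution (\<lambda>x. x\<^sup>2)"
    using integrable_std_normal_distribution_moment[of 1] integrable_std_normal_distribution_moment[of 2] by auto
  have m: "(LINT x|std_normal_distribution. x\<^sup>2) = 1" "(LINT x|std_normal_distribution. x) = 0"
    using std_normal_distribution_even_moments(1)[of 1] integral_std_normal_distribution_moment_odd[of 1]
    by (auto simp: fact_numeral)
  have one: "integrable std_normal_distribution (\<lambda>_. 1 :: real)" by simp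
  show "integrable N2 (\<lambda>p. (fst p)\<^sup>2)" "(LINT p|N2. (fst p)\<^sup>2) = 1"
    using std_normal_pair_product[OF i(2) one] m std_normal.prob_space by (auto simp: N2_def)
  show "integrable N2 (\<lambda>p. (snd p)\<^sup>2)" "(LINT p|N2. (snd p)\<^sup>2) = 1"
    using std_normal_pair_product[OF one i(2)] m std_normal.prob_space by (auto simp: N2_def)
  show "integrable N2 (\<lambda>p. fst p * snd p)" "(LINT p|N2. fst p * snd p) = 0"
    using std_normal_pair_product[OF i(1) i(1)] m by (auto simp: N2_def)
qed

lemma prob_space_gauss_matrix: "prob_space (gauss_matrix m n)"
  unfolding gauss_matrix_def by (intro prob_space_PiM prob_space_std_normal)

lemma prod_singleton_Times:
  "(\<Prod>p\<in>{k} \<times> J. g p) = (\<Prod>j\<in>J. g (k, j))"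
  by (simp add: prod.cartesian_product[symmetric, of "\<lambda>a b. g (a, b)", simplified])

text \<open>With row \<open>i\<close> fixed, the integral over row \<open>k\<close> factors over
  columns; what is left is a product of functions of single entries of row \<open>i\<close>, which
  factors again. The bound on \<open>F\<close> provides integrability.\<close>

lemma integral_two_rows:
  fixes F :: "real \<Rightarrow> real \<Rightarrow> complex" and i k n :: nat
  assumes F[measurable]: "case_prod F \<in> borel_measurable (borel \<Otimes>\<^sub>M borel)"
    and F1: "\<And>u v. norm (F u v) \<le> 1" and "i \<noteq> k"
  shows "(CLINT x|PiM ({i, k} \<times> {..<n}) (\<lambda>_. std_normal_distribution). \<Prod>j<n. F (x (i, j)) (x (k, j))) =
    (CLINT u|std_normal_distribution. CLINT v|std_normal_distribution. F u v) ^ n"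
proof -
  let ?N = std_normal_distribution
  have Fu[measurable]: "F u \<in> borel_measurable borel" for u
    using measurable_compose[OF measurable_Pair1' F, of u] by simp
  have intF: "integrable ?N (F u)" for u
    by (rule std_normal.integrable_const_bound[where B=1]) (auto simp: F1)
  have mI[measurable]: "(\<lambda>u. CLINT v|?N. F u v) \<in> borel_measurable borel"
  proof -
    have "case_prod F \<in> borel_measurable (borel \<Otimes>\<^sub>M ?N)"
      using F by (subst measurable_cong_sets[OF sets_pair_measure_cong[OF refl] refl]) auto
    then show ?thesis by (rule std_normal.borel_measurable_lebesgue_integral)
  qed
  have I1: "norm (CLINT v|?N. F u v) \<le> 1" for u
  proof -
    have "norm (CLINT v|?N. F u v) \<le> (LINT v|?N. norm (F u v))" by (rule integral_norm_bound)
    also have "\<dots> \<le> (LINT v|?N. 1)" by (intro integral_mono) (auto simp: F1 intF)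
    finally show ?thesis using std_normal.prob_space by simp
  qed
  have intI: "integrable ?N (\<lambda>u. CLINT v|?N. F u v)"
    by (rule std_normal.integrable_const_bound[where B=1]) (auto simp: I1)
  have disj: "({i} \<times> {..<n}) \<inter> ({k} \<times> {..<n}) = {}" using assms(3) by auto
  have eq: "{i, k} \<times> {..<n} = ({i} \<times> {..<n}) \<union> ({k} \<times> {..<n})" by auto
  interpret PI: prob_space "PiM ({i, k} \<times> {..<n}) (\<lambda>_. ?N)"
    by (intro prob_space_PiM prob_space_std_normal)
  have int: "integrable (PiM ({i, k} \<times> {..<n}) (\<lambda>_. ?N)) (\<lambda>x. \<Prod>j<n. F (x (i, j)) (x (k, j)))"
  proof (rule PI.integrable_const_bound[where B=1])
    show "AE x in PiM ({i, k} \<times> {..<n}) (\<lambda>_. ?N). norm (\<Prod>j<n. F (x (i, j)) (x (k, j))) \<le> 1"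
      by (auto simp: prod_norm[symmetric] F1 intro!: prod_le_1)
    have "(\<lambda>x. F (x (i, j)) (x (k, j))) \<in> borel_measurable (PiM ({i, k} \<times> {..<n}) (\<lambda>_. ?N))" if "j < n" for j
    proof -
      have "(\<lambda>x. (x (i, j), x (k, j))) \<in> PiM ({i, k} \<times> {..<n}) (\<lambda>_. ?N) \<rightarrow>\<^sub>M borel \<Otimes>\<^sub>M borel"
        using that by (intro measurable_Pair) (auto intro!: measurable_compose[OF measurable_component_singleton])
      from measurable_compose[OF this F] show ?thesis by simp
    qed
    then show "(\<lambda>x. \<Prod>j<n. F (x (i, j)) (x (k, j))) \<in> borel_measurable (PiM ({i, k} \<times> {..<n}) (\<lambda>_. ?N))"
      by (intro borel_measurable_prod) auto
  qed
  have "(CLINT x|PiM ({i, k} \<times> {..<n}) (\<lambda>_. ?N). \<Prod>j<n. F (x (i, j)) (x (k, j))) =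
    (CLINT x|PiM ({i} \<times> {..<n}) (\<lambda>_. ?N). CLINT y|PiM ({k} \<times> {..<n}) (\<lambda>_. ?N).
      \<Prod>j<n. F (merge ({i} \<times> {..<n}) ({k} \<times> {..<n}) (x, y) (i, j)) (merge ({i} \<times> {..<n}) ({k} \<times> {..<n}) (x, y) (k, j)))"
    unfolding eq using disj int[unfolded eq] by (intro std_normal_product.product_integral_fold) auto
  \<comment> \<open>The product over columns is reindexed by the matrix positions of row
    \<open>k\<close>, to match the index set of the product measure.\<close>
  also have "\<dots> = (CLINT x|PiM ({i} \<times> {..<n}) (\<lambda>_. ?N). CLINT y|PiM ({k} \<times> {..<n}) (\<lambda>_. ?N).
      \<Prod>p\<in>{k} \<times> {..<n}. F (x (i, snd p)) (y p))"
    using assms(3) unfolding prod_singleton_Times by (simp add: merge_def)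
  also have "\<dots> = (CLINT x|PiM ({i} \<times> {..<n}) (\<lambda>_. ?N). \<Prod>p\<in>{k} \<times> {..<n}. CLINT v|?N. F (x (i, snd p)) v)"
    by (intro Bochner_Integration.integral_cong refl std_normal_product.product_integral_prod) (auto simp: intF)
  also have "\<dots> = (CLINT x|PiM ({i} \<times> {..<n}) (\<lambda>_. ?N). \<Prod>p\<in>{i} \<times> {..<n}. CLINT v|?N. F (x p) v)"
    unfolding prod_singleton_Times by simp
  also have "\<dots> = (\<Prod>p\<in>{i} \<times> {..<n}. CLINT u|?N. CLINT v|?N. F u v)"
    by (intro std_normal_product.product_integral_prod[where f="\<lambda>_ u. CLINT v|?N. F u v"]) (auto simp: intI)
  finally show ?thesis by simp
qed

text \<open>With \<open>u\<close>, \<open>v\<close> the entries of two rows in one column and \<open>R\<close> the sum of the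
  \<open>r\<close> other entries, this is the logarithm of the conditional expectation of
  \<open>iexp (\<theta> (s u + t v) (u + v + R))\<close> given \<open>u\<close> and \<open>v\<close>.\<close>
definition pair_exponent :: "real \<Rightarrow> real \<Rightarrow> real \<Rightarrow> real \<Rightarrow> real \<Rightarrow> real \<Rightarrow> complex" where
  "pair_exponent \<theta> r s t u v =
    Complex (- r * (\<theta> * (s * u + t * v))\<^sup>2 / 2) (\<theta> * (s * u + t * v) * (u + v))"

lemma exp_pair_exponent:
  "exp (pair_exponent \<theta> r s t u v) =
    iexp (\<theta> * (s * u + t * v) * (u + v)) * exp (- r * (\<theta> * (s * u + t * v))\<^sup>2 / 2)"
proof -
  have "pair_exponent \<theta> r s t u v =
    complex_of_real (- r * (\<theta> * (s * u + t * v))\<^sup>2 / 2) + \<i> * complex_of_real (\<theta> * (s * u + t * v) * (u + v))"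
    unfolding pair_exponent_def by (simp add: complex_eq_iff)
  then show ?thesis by (simp only: exp_add exp_of_real mult.commute)
qed

lemma borel_measurable_pair_exponent [measurable]:
  assumes [measurable]: "f \<in> borel_measurable M" "g \<in> borel_measurable M"
  shows "(\<lambda>x. pair_exponent \<theta> r s t (f x) (g x)) \<in> borel_measurable M"
  unfolding pair_exponent_def Complex_eq by measurable

text \<open>Integrating out the rows other than \<open>i\<close> and \<open>k\<close> makes the columns separate.\<close>
lemma gauss_matrix_joint_char:
  fixes i k m n :: nat
  assumes ik: "i < m" "k < m" "i \<noteq> k"
  shows "(CLINT W|gauss_matrix m n.
      iexp (\<theta> * (\<Sum>j<n. (s * W (i, j) + t * W (k, j)) * (\<Sum>l<m. W (l, j))))) =
    (CLINT u|std_normal_distribution. CLINT v|std_normal_distribution.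
      exp (pair_exponent \<theta> (real (m - 2)) s t u v)) ^ n"
proof -
  let ?N = std_normal_distribution
  define R where "R = {..<m} - {i, k}"
  \<comment> \<open>The two distinct rows lie below \<open>m\<close>, so the subtraction in
    \<open>m - 2\<close> is not truncated.\<close>
  have R: "finite R" "card R = m - 2" using ik by (auto simp: R_def card_Diff_subset)
  define I where "I = {i, k} \<times> {..<n}"
  define J where "J = R \<times> {..<n}"
  have IJ: "I \<inter> J = {}" "finite I" "finite J" "{..<m} \<times> {..<n} = I \<union> J"
    using ik R by (auto simp: I_def J_def R_def)
  interpret P: prob_space "gauss_matrix m n" by (rule prob_space_gauss_matrix)
  define G where "G W = iexp (\<theta> * (\<Sum>j<n. (s * W (i, j) + t * W (k, j)) * (\<Sum>l<m. W (l, j))))"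
    for W :: "nat \<times> nat \<Rightarrow> real"
  have "integrable (gauss_matrix m n) G"
    unfolding G_def using ik by (intro P.integrable_iexp) auto
  then have int: "integrable (PiM (I \<union> J) (\<lambda>_. ?N)) G"
    by (simp add: gauss_matrix_def IJ(4))
  \<comment> \<open>For fixed rows \<open>i\<close> and \<open>k\<close>, this is the common
    coefficient in the exponent of every other entry of column \<open>j\<close>.\<close>
  define d where "d x j = \<theta> * (s * x (i, j) + t * x (k, j))" for x :: "nat \<times> nat \<Rightarrow> real" and j
  have G_merge: "G (merge I J (x, y)) =
      (\<Prod>j<n. iexp (d x j * (x (i, j) + x (k, j)))) * (\<Prod>p\<in>J. iexp (d x (snd p) * y p))" for x y
  proof -
    let ?m = "merge I J (x, y)"
    have mI: "?m (i, j) = x (i, j)" "?m (k, j) = x (k, j)" if "j < n" for j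
      using that by (auto simp: merge_def I_def)
    have mJ: "?m (l, j) = y (l, j)" if "j < n" "l \<in> R" for l j
      using that IJ(1) by (auto simp: merge_def I_def J_def R_def)
    have split: "(\<Sum>l<m. ?m (l, j)) = x (i, j) + x (k, j) + (\<Sum>l\<in>R. y (l, j))" if "j < n" for j
    proof -
      have eq: "{..<m} = insert i (insert k R)" and "i \<notin> insert k R" "k \<notin> R"
        using ik by (auto simp: R_def)
      then have "(\<Sum>l<m. ?m (l, j)) = ?m (i, j) + ?m (k, j) + (\<Sum>l\<in>R. ?m (l, j))"
        unfolding eq using R(1) by simp
      then show ?thesis using that by (simp add: mI mJ)
    qed
    have "G ?m = iexp (\<Sum>j<n. d x j * (x (i, j) + x (k, j)) + (\<Sum>l\<in>R. d x j * y (l, j)))"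
      unfolding G_def sum_distrib_left[of \<theta>]
      by (intro arg_cong[where f=iexp] sum.cong refl)
        (simp add: mI split d_def flip: sum_distrib_left, simp add: algebra_simps)
    also have "\<dots> = iexp ((\<Sum>j<n. d x j * (x (i, j) + x (k, j))) + (\<Sum>p\<in>J. d x (snd p) * y p))"
    proof -
      have "(\<Sum>p\<in>J. d x (snd p) * y p) = (\<Sum>l\<in>R. \<Sum>j<n. d x j * y (l, j))"
        unfolding J_def by (subst sum.cartesian_product) (auto intro!: sum.cong)
      also have "\<dots> = (\<Sum>j<n. \<Sum>l\<in>R. d x j * y (l, j))" by (rule sum.swap)
      finally show ?thesis by (simp add: sum.distrib)
    qed
    also have "\<dots> = (\<Prod>j<n. iexp (d x j * (x (i, j) + x (k, j)))) * (\<Prod>p\<in>J. iexp (d x (snd p) * y p))"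
      by (simp add: exp_add exp_sum IJ sum_distrib_left distrib_left del: of_real_mult)
    finally show ?thesis .
  qed
  have inner: "(CLINT y|PiM J (\<lambda>_. ?N). G (merge I J (x, y))) =
      (\<Prod>j<n. exp (pair_exponent \<theta> (real (m - 2)) s t (x (i, j)) (x (k, j))))" for x
  proof -
    \<comment> \<open>The exponent is linear in \<open>y\<close>, so the integral factors into
      one-dimensional normal characteristic functions; column \<open>j\<close> contributes
      \<open>m - 2\<close> equal factors.\<close>
    have "(CLINT y|PiM J (\<lambda>_. ?N). \<Prod>p\<in>J. iexp (d x (snd p) * y p)) =
        (\<Prod>p\<in>J. CLINT z|?N. iexp (d x (snd p) * z))"
      using IJ by (intro std_normal_product.product_integral_prod) (auto intro!: std_normal.integrable_iexp)
    also have "\<dots> = (\<Prod>p\<in>J. complex_of_real (exp (- (d x (snd p))\<^sup>2 / 2)))"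
      unfolding integral_iexp_std_normal ..
    also have "\<dots> = (\<Prod>l\<in>R. \<Prod>j<n. complex_of_real (exp (- (d x j)\<^sup>2 / 2)))"
      unfolding J_def by (subst prod.cartesian_product) (auto intro!: prod.cong)
    also have "\<dots> = (\<Prod>j<n. complex_of_real (exp (- (d x j)\<^sup>2 / 2)) ^ (m - 2))"
      by (subst prod.swap) (simp add: R)
    also have "\<dots> = (\<Prod>j<n. complex_of_real (exp (- real (m - 2) * (d x j)\<^sup>2 / 2)))"
      by (simp flip: of_real_power exp_of_nat_mult)
    finally have "(CLINT y|PiM J (\<lambda>_. ?N). \<Prod>p\<in>J. iexp (d x (snd p) * y p)) =
      (\<Prod>j<n. complex_of_real (exp (- real (m - 2) * (d x j)\<^sup>2 / 2)))" .
    then show ?thesis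
      unfolding G_merge integral_mult_right_zero exp_pair_exponent prod.distrib d_def by simp
  qed
  have "(CLINT W|gauss_matrix m n. G W) = (CLINT x|PiM I (\<lambda>_. ?N). CLINT y|PiM J (\<lambda>_. ?N). G (merge I J (x, y)))"
    unfolding gauss_matrix_def IJ(4) using IJ int by (intro std_normal_product.product_integral_fold) auto
  also have "\<dots> = (CLINT x|PiM I (\<lambda>_. ?N). \<Prod>j<n. exp (pair_exponent \<theta> (real (m - 2)) s t (x (i, j)) (x (k, j))))"
    unfolding inner ..
  also have "\<dots> = (CLINT u|?N. CLINT v|?N. exp (pair_exponent \<theta> (real (m - 2)) s t u v)) ^ n"
    unfolding I_def
  proof (rule integral_two_rows)
    show "case_prod (\<lambda>u v. exp (pair_exponent \<theta> (real (m - 2)) s t u v)) \<in> borel_measurable (borel \<Otimes>\<^sub>M borel)"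
      unfolding split_beta' by measurable
    show "norm (exp (pair_exponent \<theta> (real (m - 2)) s t u v)) \<le> 1" for u v
      using mult_nonneg_nonneg[of "real (m - 2)" "(\<theta> * (s * u + t * v))\<^sup>2"]
      by (simp add: pair_exponent_def del: of_nat_diff mult_nonneg_nonneg)
  qed (rule ik)
  finally show ?thesis by (simp add: G_def)
qed

text \<open>By \<open>tendsto_power_exp\<close> only \<open>n\<close> times the deviation of the
  column integral from 1 matters. To first order this is the mean of \<open>n\<close> times the
  exponent. Since \<open>u\<close> and \<open>v\<close> are uncorrelated with variance 1, the
  squared form \<open>(s * u + t * v)\<^sup>2\<close> has mean \<open>s\<^sup>2 + t\<^sup>2\<close>,
  and its product with \<open>u + v\<close> has mean \<open>s + t\<close>, the source of the shift
  \<open>1 / sqrt c\<close>.\<close>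

lemma tendsto_pair_char_power:
  fixes m :: "nat \<Rightarrow> nat" and c :: real
  assumes ratio: "(\<lambda>n. real (m n) / real n) \<longlonglongrightarrow> c" and "c > 0"
  shows "(\<lambda>n. (CLINT u|std_normal_distribution. CLINT v|std_normal_distribution.
      exp (pair_exponent (1 / sqrt (real (m n) * real n)) (real (m n - 2)) s t u v)) ^ n) \<longlonglongrightarrow>
    exp (Complex (- (s\<^sup>2 + t\<^sup>2) / 2) ((s + t) / sqrt c))"
proof -
  let ?N = std_normal_distribution
  let ?N2 = "?N \<Otimes>\<^sub>M ?N"
  define \<theta> where "\<theta> n = 1 / sqrt (real (m n) * real n)" for n
  define z where "z n u v = pair_exponent (\<theta> n) (real (m n - 2)) s t u v" for n u v
  have z_meas [measurable]: "(\<lambda>p. z n (fst p) (snd p)) \<in> borel_measurable (borel \<Otimes>\<^sub>M borel)" for n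
    unfolding z_def by measurable
  have Re_z: "Re (z n u v) \<le> 0" for n u v by (simp add: z_def pair_exponent_def)
  have int_exp: "integrable ?N2 (\<lambda>p. exp (z n (fst p) (snd p)))" for n
    by (rule std_normal_pair.P.integrable_const_bound[where B=1]) (use Re_z in auto)
  have Fubini: "(CLINT u|?N. CLINT v|?N. exp (z n u v)) = (CLINT p|?N2. exp (z n (fst p) (snd p)))" for n
    using std_normal_pair.integral_fst'[OF int_exp, of n] by simp
  have ev: "\<forall>\<^sub>F n in sequentially. n > 0 \<and> m n > 0"
  proof -
    have "\<forall>\<^sub>F n in sequentially. real (m n) / real n > 0" using order_tendstoD(1)[OF ratio] \<open>c > 0\<close> by auto
    then show ?thesis by eventually_elim (auto simp: zero_less_divide_iff)
  qed
  have lim1: "(\<lambda>n. real n * \<theta> n) \<longlonglongrightarrow> 1 / sqrt c"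
  proof -
    have "(\<lambda>n. 1 / sqrt (real (m n) / real n)) \<longlonglongrightarrow> 1 / sqrt c"
      using \<open>c > 0\<close> by (intro tendsto_intros ratio) auto
    moreover have "\<forall>\<^sub>F n in sequentially. 1 / sqrt (real (m n) / real n) = real n * \<theta> n"
      using ev by eventually_elim (auto simp: \<theta>_def real_sqrt_mult real_sqrt_divide field_simps)
    ultimately show ?thesis by (rule Lim_transform_eventually)
  qed
  have m_inf: "filterlim (\<lambda>n. real (m n)) at_top sequentially"
  proof -
    have "filterlim (\<lambda>n. real (m n) / real n * real n) at_top sequentially"
      using \<open>c > 0\<close> by (intro filterlim_tendsto_pos_mult_at_top[OF ratio] filterlim_real_sequentially)
    moreover have "\<forall>\<^sub>F n in sequentially. real (m n) / real n * real n = real (m n)"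
      using ev by eventually_elim auto
    ultimately show ?thesis by (simp cong: filterlim_cong)
  qed
  have lim2: "(\<lambda>n. real n * (real (m n - 2) * (\<theta> n)\<^sup>2)) \<longlonglongrightarrow> 1"
  proof -
    have "(\<lambda>n. 1 - 2 / real (m n)) \<longlonglongrightarrow> 1 - 0"
      by (intro tendsto_intros tendsto_divide_0[OF tendsto_const] filterlim_at_top_imp_at_infinity m_inf)
    moreover have "\<forall>\<^sub>F n in sequentially. 1 - 2 / real (m n) = real n * (real (m n - 2) * (\<theta> n)\<^sup>2)"
      using ev filterlim_at_top_dense[THEN iffD1, OF m_inf, rule_format, of 2]
      by eventually_elim (auto simp: \<theta>_def power_divide of_nat_diff field_simps)
    ultimately show ?thesis by (simp add: Lim_transform_eventually)
  qed
  define zl where "zl u v = Complex (- (s * u + t * v)\<^sup>2 / 2) ((s * u + t * v) * (u + v) / sqrt c)" for u v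
  have nz: "of_nat n * z n u v =
      Complex (real n * (real (m n - 2) * (\<theta> n)\<^sup>2) * (- (s * u + t * v)\<^sup>2 / 2))
        (real n * \<theta> n * ((s * u + t * v) * (u + v)))" for n u v
    by (simp add: z_def pair_exponent_def complex_eq_iff power_mult_distrib)
  have lim_z: "(\<lambda>n. of_nat n * z n u v) \<longlonglongrightarrow> zl u v" for u v
  proof -
    have "(\<lambda>n. Complex (real n * (real (m n - 2) * (\<theta> n)\<^sup>2) * (- (s * u + t * v)\<^sup>2 / 2))
        (real n * \<theta> n * ((s * u + t * v) * (u + v)))) \<longlonglongrightarrow>
        Complex (1 * (- (s * u + t * v)\<^sup>2 / 2)) (1 / sqrt c * ((s * u + t * v) * (u + v)))"
      by (intro tendsto_Complex tendsto_mult lim1 lim2 tendsto_const)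
    then show ?thesis unfolding nz by (simp add: zl_def)
  qed
  \<comment> \<open>Convergent sequences are bounded at every index, so one integrable function
    \<open>w\<close> dominates for all \<open>n\<close>, including small ones where
    \<open>\<theta> n\<close> or \<open>m n - 2\<close> takes a default value.\<close>
  obtain K1 where K1: "\<And>n. \<bar>real n * \<theta> n\<bar> \<le> K1"
    using convergent_imp_Bseq[OF convergentI[OF lim1]] by (auto simp: Bseq_def)
  obtain K2 where K2: "\<And>n. \<bar>real n * (real (m n - 2) * (\<theta> n)\<^sup>2)\<bar> \<le> K2"
    using convergent_imp_Bseq[OF convergentI[OF lim2]] by (auto simp: Bseq_def)
  define w where "w p = K2 * \<bar>- (s * fst p + t * snd p)\<^sup>2 / 2\<bar> +
      K1 * \<bar>(s * fst p + t * snd p) * (fst p + snd p)\<bar>" for p :: "real \<times> real"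
  have norm_le: "norm (of_nat n * (exp (z n u v) - 1)) \<le> w (u, v)" for n u v
  proof -
    have "norm (of_nat n * (exp (z n u v) - 1)) \<le> norm (of_nat n * z n u v)"
      unfolding norm_mult by (intro mult_left_mono norm_exp_minus_1_le Re_z) auto
    also have "\<dots> \<le> \<bar>Re (of_nat n * z n u v)\<bar> + \<bar>Im (of_nat n * z n u v)\<bar>" by (rule cmod_le)
    also have "\<dots> \<le> w (u, v)"
      unfolding nz w_def complex.sel abs_mult[of "real n * (real (m n - 2) * (\<theta> n)\<^sup>2)"]
        abs_mult[of "real n * \<theta> n"] fst_conv snd_conv
      by (intro add_mono mult_right_mono K1 K2) auto
    finally show ?thesis .
  qed
  have sq: "(\<lambda>p. (s * fst p + t * snd p)\<^sup>2) =
      (\<lambda>p. s\<^sup>2 * (fst p)\<^sup>2 + 2 * s * t * (fst p * snd p) + t\<^sup>2 * (snd p)\<^sup>2)"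
    by (auto simp: power2_eq_square algebra_simps)
  have pr: "(\<lambda>p. (s * fst p + t * snd p) * (fst p + snd p)) =
      (\<lambda>p. s * (fst p)\<^sup>2 + (s + t) * (fst p * snd p) + t * (snd p)\<^sup>2)"
    by (auto simp: power2_eq_square algebra_simps)
  have int_sq: "integrable ?N2 (\<lambda>p. (s * fst p + t * snd p)\<^sup>2)"
    unfolding sq by (intro Bochner_Integration.integrable_add integrable_mult_right std_normal_pair_monomials)
  have int_pr: "integrable ?N2 (\<lambda>p. (s * fst p + t * snd p) * (fst p + snd p))"
    unfolding pr by (intro Bochner_Integration.integrable_add integrable_mult_right std_normal_pair_monomials)
  have val_sq: "(LINT p|?N2. (s * fst p + t * snd p)\<^sup>2) = s\<^sup>2 + t\<^sup>2"
    unfolding sq using std_normal_pair_monomials by simp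
  have val_pr: "(LINT p|?N2. (s * fst p + t * snd p) * (fst p + snd p)) = s + t"
    unfolding pr using std_normal_pair_monomials by simp
  have int_w: "integrable ?N2 w"
    unfolding w_def using int_sq int_pr
    by (intro Bochner_Integration.integrable_add integrable_mult_right integrable_abs) auto
  have zl_eq: "zl (fst p) (snd p) = complex_of_real (- ((s * fst p + t * snd p)\<^sup>2) / 2) +
      \<i> * complex_of_real ((s * fst p + t * snd p) * (fst p + snd p) / sqrt c)" for p
    by (simp add: zl_def complex_eq_iff)
  have "(\<lambda>n. CLINT p|?N2. of_nat n * (exp (z n (fst p) (snd p)) - 1)) \<longlonglongrightarrow> (CLINT p|?N2. zl (fst p) (snd p))"
  proof (rule integral_dominated_convergence[where w=w])
    show "AE p in ?N2. (\<lambda>n. of_nat n * (exp (z n (fst p) (snd p)) - 1)) \<longlonglongrightarrow> zl (fst p) (snd p)"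
      by (intro AE_I2 tendsto_n_times_exp_minus_1 lim_z)
    show "AE p in ?N2. norm (of_nat n * (exp (z n (fst p) (snd p)) - 1)) \<le> w p" for n
      using norm_le[of n] by (intro AE_I2) (metis prod.collapse)
  qed (use int_w in \<open>auto simp: zl_eq\<close>)
  moreover have "(CLINT p|?N2. zl (fst p) (snd p)) = Complex (- (s\<^sup>2 + t\<^sup>2) / 2) ((s + t) / sqrt c)"
  proof -
    have "(CLINT p|?N2. zl (fst p) (snd p)) =
        complex_of_real (LINT p|?N2. - ((s * fst p + t * snd p)\<^sup>2) / 2) +
        \<i> * complex_of_real (LINT p|?N2. (s * fst p + t * snd p) * (fst p + snd p) / sqrt c)"
      unfolding zl_eq using int_sq int_pr
      by (subst Bochner_Integration.integral_add)
        (auto intro!: integrable_mult_right integrable_of_real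
          simp del: of_real_mult of_real_divide of_real_minus of_real_power)
    also have "(LINT p|?N2. - ((s * fst p + t * snd p)\<^sup>2) / 2) = - (s\<^sup>2 + t\<^sup>2) / 2"
      using val_sq by (simp add: field_simps)
    also have "(LINT p|?N2. (s * fst p + t * snd p) * (fst p + snd p) / sqrt c) = (s + t) / sqrt c"
      using val_pr by simp
    also have "complex_of_real (- (s\<^sup>2 + t\<^sup>2) / 2) + \<i> * complex_of_real ((s + t) / sqrt c) =
        Complex (- (s\<^sup>2 + t\<^sup>2) / 2) ((s + t) / sqrt c)"
      by (simp add: Complex_eq)
    finally show ?thesis .
  qed
  moreover have "(CLINT p|?N2. of_nat n * (exp (z n (fst p) (snd p)) - 1)) =
      of_nat n * ((CLINT p|?N2. exp (z n (fst p) (snd p))) - 1)" for n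
    using int_exp[of n] std_normal_pair.P.prob_space by simp
  ultimately have "(\<lambda>n. of_nat n * ((CLINT p|?N2. exp (z n (fst p) (snd p))) - 1)) \<longlonglongrightarrow>
      Complex (- (s\<^sup>2 + t\<^sup>2) / 2) ((s + t) / sqrt c)" by (simp only:)
  then have "(\<lambda>n. (CLINT p|?N2. exp (z n (fst p) (snd p))) ^ n) \<longlonglongrightarrow>
      exp (Complex (- (s\<^sup>2 + t\<^sup>2) / 2) ((s + t) / sqrt c))"
  proof (rule tendsto_power_exp[rotated 2])
    fix n
    have "norm (CLINT p|?N2. exp (z n (fst p) (snd p))) \<le> (LINT p|?N2. norm (exp (z n (fst p) (snd p))))"
      by (rule integral_norm_bound)
    also have "\<dots> \<le> (LINT p|?N2. 1)"
      using Re_z by (intro integral_mono integrable_norm int_exp) auto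
    finally show "norm (CLINT p|?N2. exp (z n (fst p) (snd p))) \<le> 1"
      using std_normal_pair.P.prob_space by simp
  qed auto
  then show ?thesis unfolding Fubini[symmetric] unfolding z_def \<theta>_def .
qed

section \<open>Concentration of the number of active rows\<close>

definition row_score :: "nat \<Rightarrow> nat \<Rightarrow> nat \<Rightarrow> (nat \<times> nat \<Rightarrow> real) \<Rightarrow> real" where
  "row_score m n i W = (1 / sqrt (real m * real n)) * (\<Sum>j<n. W (i, j) * (\<Sum>l<m. W (l, j)))"

lemma measurable_row_score [measurable]: "row_score m n i \<in> borel_measurable (gauss_matrix m n)"
  unfolding row_score_def by measurable

text \<open>The limit law of a score. Written as a translate, it inherits distribution function,
  continuity and characteristic function from the standard normal law.\<close>

definition shifted_normal :: "real \<Rightarrow> real measure" where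
  "shifted_normal a = distr std_normal_distribution borel (\<lambda>x. x + a)"

lemma real_distribution_shifted_normal: "real_distribution (shifted_normal a)"
  unfolding real_distribution_def real_distribution_axioms_def shifted_normal_def
  by (auto intro!: prob_space.prob_space_distr[OF prob_space_std_normal])

lemma cdf_shifted_normal: "cdf (shifted_normal a) x = cdf std_normal_distribution (x - a)"
proof -
  have "(\<lambda>x. x + a) -` {..x} = {..x - a}" by auto
  then show ?thesis by (simp add: cdf_def shifted_normal_def measure_distr)
qed

lemma isCont_cdf_shifted_normal: "isCont (cdf (shifted_normal a)) x"
  unfolding cdf_shifted_normal[abs_def]
  by (intro isCont_o2[OF _ isCont_cdf_std_normal]) (intro continuous_intros)

lemma char_shifted_normal:
  "char (shifted_normal a) s = exp (Complex (- s\<^sup>2 / 2) (s * a))"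
proof -
  have "char (shifted_normal a) s = (CLINT x|std_normal_distribution. iexp (s * a) * iexp (s * x))"
    unfolding char_def shifted_normal_def
    by (subst integral_distr) (auto simp: exp_add[symmetric] algebra_simps)
  also have "\<dots> = iexp (s * a) * exp (- (s\<^sup>2) / 2)"
    by (simp only: integral_mult_right_zero integral_iexp_std_normal)
  also have "\<dots> = exp (complex_of_real (- s\<^sup>2 / 2) + \<i> * complex_of_real (s * a))"
    by (simp only: exp_add exp_of_real mult.commute)
  also have "complex_of_real (- s\<^sup>2 / 2) + \<i> * complex_of_real (s * a) = Complex (- s\<^sup>2 / 2) (s * a)"
    by (simp add: Complex_eq)
  finally show ?thesis .
qed

text \<open>The rows may vary with \<open>n\<close>, so that an extremal pair can be inserted later.
  The limit characteristic function factors, hence the joint and marginal probabilities tend to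
  \<open>p * p\<close> and \<open>p\<close>, and the expanded covariance-type expression
  cancels.\<close>

lemma row_score_pair_decorrelates:
  fixes m i k :: "nat \<Rightarrow> nat" and c :: real
  defines "p \<equiv> cdf std_normal_distribution (- (1 / sqrt c))"
  assumes ratio: "(\<lambda>n. real (m n) / real n) \<longlonglongrightarrow> c" and "c > 0"
    and ik: "\<forall>\<^sub>F n in sequentially. i n < m n \<and> k n < m n \<and> i n \<noteq> k n"
  shows "(\<lambda>n. LINT W|gauss_matrix (m n) n.
      (indicator {..0} (row_score (m n) n (i n) W) - p) *
      (indicator {..0} (row_score (m n) n (k n) W) - p)) \<longlonglongrightarrow> 0"
proof -
  interpret P: prob_space "gauss_matrix (m n) n" for n by (rule prob_space_gauss_matrix)
  let ?\<mu> = "shifted_normal (1 / sqrt c)"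
  let ?X = "\<lambda>n. row_score (m n) n (i n)" and ?Z = "\<lambda>n. row_score (m n) n (k n)"
  have "(\<lambda>n. CLINT W|gauss_matrix (m n) n. iexp (s * ?X n W + t * ?Z n W)) \<longlonglongrightarrow> char ?\<mu> s * char ?\<mu> t" for s t
  proof -
    have lim: "(\<lambda>n. (CLINT u|std_normal_distribution. CLINT v|std_normal_distribution.
      exp (pair_exponent (1 / sqrt (real (m n) * real n)) (real (m n - 2)) s t u v)) ^ n) \<longlonglongrightarrow>
      exp (Complex (- (s\<^sup>2 + t\<^sup>2) / 2) ((s + t) / sqrt c))"
      by (rule tendsto_pair_char_power[OF ratio \<open>c > 0\<close>])
    have "\<forall>\<^sub>F n in sequentially. (CLINT u|std_normal_distribution. CLINT v|std_normal_distribution.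
        exp (pair_exponent (1 / sqrt (real (m n) * real n)) (real (m n - 2)) s t u v)) ^ n =
      (CLINT W|gauss_matrix (m n) n. iexp (s * ?X n W + t * ?Z n W))"
      using ik
    proof eventually_elim
      case (elim n)
      have "s * ?X n W + t * ?Z n W = 1 / sqrt (real (m n) * real n) *
          (\<Sum>j<n. (s * W (i n, j) + t * W (k n, j)) * (\<Sum>l<m n. W (l, j)))" for W
        unfolding row_score_def distrib_right sum.distrib
        by (simp add: sum_distrib_left distrib_left mult_ac)
      then show ?case
        using gauss_matrix_joint_char[of "i n" "m n" "k n" n "1 / sqrt (real (m n) * real n)" s t] elim by simp
    qed
    from Lim_transform_eventually[OF lim this]
    have "(\<lambda>n. CLINT W|gauss_matrix (m n) n. iexp (s * ?X n W + t * ?Z n W)) \<longlonglongrightarrow>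
      exp (Complex (- (s\<^sup>2 + t\<^sup>2) / 2) ((s + t) / sqrt c))" .
    also have "exp (Complex (- (s\<^sup>2 + t\<^sup>2) / 2) ((s + t) / sqrt c)) = char ?\<mu> s * char ?\<mu> t"
      unfolding char_shifted_normal exp_add[symmetric]
      by (intro arg_cong[where f=exp]) (simp add: complex_eq_iff diff_divide_distrib add_divide_distrib)
    finally show ?thesis .
  qed
  note lims = joint_levy_continuity[of "\<lambda>n. gauss_matrix (m n) n" ?X ?Z ?\<mu> 0 ?\<mu> 0,
      OF prob_space_gauss_matrix measurable_row_score measurable_row_score
        real_distribution_shifted_normal isCont_cdf_shifted_normal
        real_distribution_shifted_normal isCont_cdf_shifted_normal this]
  have p: "cdf ?\<mu> 0 = p" by (simp add: cdf_shifted_normal p_def)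
  have int: "integrable (gauss_matrix (m n) n) (\<lambda>W. indicator {..0} (row_score (m n) n (k n) W) :: real)" for n k
    by (rule P.integrable_const_bound[where B=1]) auto
  have int2: "integrable (gauss_matrix (m n) n)
      (\<lambda>W. indicator {..0} (?X n W) * indicator {..0} (?Z n W) :: real)" for n
    by (rule P.integrable_const_bound[where B=1]) (auto simp: indicator_def)
  have "(LINT W|gauss_matrix (m n) n. (indicator {..0} (?X n W) - p) * (indicator {..0} (?Z n W) - p)) =
      (LINT W|gauss_matrix (m n) n. indicator {..0} (?X n W) * indicator {..0} (?Z n W)) -
      p * (LINT W|gauss_matrix (m n) n. indicator {..0} (?X n W)) -
      p * (LINT W|gauss_matrix (m n) n. indicator {..0} (?Z n W)) + p * p" for n
  proof -
    have "(LINT W|gauss_matrix (m n) n. (indicator {..0} (?X n W) - p) * (indicator {..0} (?Z n W) - p)) =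
        (LINT W|gauss_matrix (m n) n. indicator {..0} (?X n W) * indicator {..0} (?Z n W) -
          p * indicator {..0} (?X n W) - p * indicator {..0} (?Z n W) + p * p)"
      by (intro Bochner_Integration.integral_cong refl) (simp add: algebra_simps)
    also have "\<dots> = (LINT W|gauss_matrix (m n) n. indicator {..0} (?X n W) * indicator {..0} (?Z n W)) -
      p * (LINT W|gauss_matrix (m n) n. indicator {..0} (?X n W)) -
      p * (LINT W|gauss_matrix (m n) n. indicator {..0} (?Z n W)) + p * p"
      using int int2[of n] by (simp add: P.prob_space)
    finally show ?thesis .
  qed
  moreover have "(\<lambda>n. (LINT W|gauss_matrix (m n) n. indicator {..0} (?X n W) * indicator {..0} (?Z n W)) -
      p * (LINT W|gauss_matrix (m n) n. indicator {..0} (?X n W)) -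
      p * (LINT W|gauss_matrix (m n) n. indicator {..0} (?Z n W)) + p * p) \<longlonglongrightarrow> p * p - p * p - p * p + p * p"
    using lims unfolding p by (intro tendsto_intros)
  ultimately show ?thesis by simp
qed

text \<open>Taking the pair of rows that maximises the correlation makes the previous limit uniform.\<close>
lemma active_rows_second_moment:
  fixes m :: "nat \<Rightarrow> nat" and c :: real
  defines "p \<equiv> cdf std_normal_distribution (- (1 / sqrt c))"
  assumes ratio: "(\<lambda>n. real (m n) / real n) \<longlonglongrightarrow> c" and "c > 0"
  shows "(\<lambda>n. (LINT W|gauss_matrix (m n) n.
      (\<Sum>i<m n. indicator {..0} (row_score (m n) n i W) - p)\<^sup>2) / (real n)\<^sup>2) \<longlonglongrightarrow> 0"
proof -
  interpret P: prob_space "gauss_matrix (m n) n" for n by (rule prob_space_gauss_matrix)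
  interpret N: real_distribution std_normal_distribution by (rule real_dist_normal_dist)
  have p: "0 \<le> p" "p \<le> 1" using N.cdf_nonneg N.cdf_bounded_prob by (auto simp: p_def)
  define D :: "nat \<Rightarrow> nat \<Rightarrow> (nat \<times> nat \<Rightarrow> real) \<Rightarrow> real"
    where "D n i W = indicator {..0} (row_score (m n) n i W) - p" for n i W
  have [measurable]: "D n i \<in> borel_measurable (gauss_matrix (m n) n)" for n i
    unfolding D_def by measurable
  have D1: "\<bar>D n i W\<bar> \<le> 1" for n i W using p by (auto simp: D_def indicator_def)
  have DD1: "\<bar>D n i W * D n k W\<bar> \<le> 1" for n i k W
    unfolding abs_mult using mult_mono[OF D1 D1] by simp
  have int: "integrable (gauss_matrix (m n) n) (\<lambda>W. D n i W * D n k W)" for n i k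
    by (rule P.integrable_const_bound[where B=1]) (use DD1 in auto)
  define f where "f n q = (LINT W|gauss_matrix (m n) n. D n (fst q) W * D n (snd q) W)" for n and q :: "nat \<times> nat"
  have f1: "f n q \<le> 1" for n q
  proof -
    have "f n q \<le> (LINT W|gauss_matrix (m n) n. 1)"
      unfolding f_def using DD1 by (intro integral_mono int) (auto simp: abs_le_iff)
    then show ?thesis by (simp add: P.prob_space)
  qed
  define Q where "Q n = {(i, k). i < m n \<and> k < m n \<and> i \<noteq> k}" for n
  \<comment> \<open>With fewer than two rows there is no pair to maximise over, and
    \<open>q n\<close> is left arbitrary.\<close>
  have "\<exists>q. 2 \<le> m n \<longrightarrow> q \<in> Q n \<and> (\<forall>q'\<in>Q n. f n q' \<le> f n q)" for n
  proof (cases "2 \<le> m n")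
    case True
    have "finite (Q n)" by (rule finite_subset[of _ "{..<m n} \<times> {..<m n}"]) (auto simp: Q_def)
    moreover have "Q n \<noteq> {}"
    proof -
      have "(0, 1) \<in> Q n" using True by (auto simp: Q_def)
      then show ?thesis by blast
    qed
    ultimately have "Max (f n ` Q n) \<in> f n ` Q n" "\<forall>q'\<in>Q n. f n q' \<le> Max (f n ` Q n)"
      by (auto intro!: Max_in)
    then show ?thesis by (metis imageE)
  qed auto
  then have "\<forall>n. \<exists>q. 2 \<le> m n \<longrightarrow> q \<in> Q n \<and> (\<forall>q'\<in>Q n. f n q' \<le> f n q)" ..
  from choice[OF this] obtain q
    where q: "\<And>n. 2 \<le> m n \<Longrightarrow> q n \<in> Q n" "\<And>n q'. 2 \<le> m n \<Longrightarrow> q' \<in> Q n \<Longrightarrow> f n q' \<le> f n (q n)"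
    by blast
  have ev: "\<forall>\<^sub>F n in sequentially. 2 \<le> m n \<and> n > 0"
  proof -
    have "filterlim (\<lambda>n. real (m n) / real n * real n) at_top sequentially"
      using \<open>c > 0\<close> by (intro filterlim_tendsto_pos_mult_at_top[OF ratio] filterlim_real_sequentially)
    then have "\<forall>\<^sub>F n in sequentially. real (m n) / real n * real n \<ge> 2"
      by (simp add: filterlim_at_top)
    then show ?thesis using eventually_gt_at_top[of 0] by eventually_elim auto
  qed
  have "(\<lambda>n. f n (q n)) \<longlonglongrightarrow> 0"
    unfolding f_def D_def p_def
  proof (rule row_score_pair_decorrelates[OF ratio \<open>c > 0\<close>])
    show "\<forall>\<^sub>F n in sequentially. fst (q n) < m n \<and> snd (q n) < m n \<and> fst (q n) \<noteq> snd (q n)"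
      using ev by eventually_elim (use q(1) in \<open>force simp: Q_def\<close>)
  qed
  \<comment> \<open>This is the second-moment bound divided by n^2: the \<open>m n\<close> diagonal
    terms are at most 1 each, and the off-diagonal ones are controlled by the maximal pair.\<close>
  then have "(\<lambda>n. real (m n) / real n * inverse (real n) + (real (m n) / real n)\<^sup>2 * \<bar>f n (q n)\<bar>)
      \<longlonglongrightarrow> c * 0 + c\<^sup>2 * \<bar>0\<bar>"
    by (intro tendsto_intros ratio lim_inverse_n)
  then have bound_lim: "(\<lambda>n. real (m n) / real n * inverse (real n) + (real (m n) / real n)\<^sup>2 * \<bar>f n (q n)\<bar>)
      \<longlonglongrightarrow> 0" by simp
  have second: "(LINT W|gauss_matrix (m n) n. (\<Sum>i<m n. D n i W)\<^sup>2) \<le> real (m n) + (real (m n))\<^sup>2 * \<bar>f n (q n)\<bar>"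
    if "2 \<le> m n" for n
  proof -
    have "(LINT W|gauss_matrix (m n) n. (\<Sum>i<m n. D n i W)\<^sup>2) =
        (LINT W|gauss_matrix (m n) n. (\<Sum>i<m n. \<Sum>k<m n. D n i W * D n k W))"
      by (simp add: power2_eq_square sum_product)
    also have "\<dots> = (\<Sum>i<m n. \<Sum>k<m n. f n (i, k))"
      unfolding f_def by (simp add: Bochner_Integration.integral_sum int)
    also have "\<dots> \<le> (\<Sum>i<m n. \<Sum>k<m n. (if k = i then 1 else 0) + \<bar>f n (q n)\<bar>)"
    proof (intro sum_mono)
      fix i k assume "i \<in> {..<m n}" "k \<in> {..<m n}"
      then have "f n (i, k) \<le> \<bar>f n (q n)\<bar>" if "i \<noteq> k"
        using q(2)[OF \<open>2 \<le> m n\<close>, of "(i, k)"] that by (auto simp: Q_def)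
      moreover have "f n (i, k) \<le> 1 + \<bar>f n (q n)\<bar>" using f1[of n "(i, k)"] by simp
      ultimately show "f n (i, k) \<le> (if k = i then 1 else 0) + \<bar>f n (q n)\<bar>" by auto
    qed
    also have "\<dots> = real (m n) + (real (m n))\<^sup>2 * \<bar>f n (q n)\<bar>"
      by (simp add: sum.distrib power2_eq_square algebra_simps)
    finally show ?thesis .
  qed
  have "(\<lambda>n. (LINT W|gauss_matrix (m n) n. (\<Sum>i<m n. D n i W)\<^sup>2) / (real n)\<^sup>2) \<longlonglongrightarrow> 0"
  proof (rule Lim_null_comparison[OF _ bound_lim])
    show "\<forall>\<^sub>F n in sequentially. norm ((LINT W|gauss_matrix (m n) n. (\<Sum>i<m n. D n i W)\<^sup>2) / (real n)\<^sup>2) \<le>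
      real (m n) / real n * inverse (real n) + (real (m n) / real n)\<^sup>2 * \<bar>f n (q n)\<bar>"
      using ev
    proof eventually_elim
      case (elim n)
      have "0 \<le> (LINT W|gauss_matrix (m n) n. (\<Sum>i<m n. D n i W)\<^sup>2)" by simp
      then have "norm ((LINT W|gauss_matrix (m n) n. (\<Sum>i<m n. D n i W)\<^sup>2) / (real n)\<^sup>2) =
        (LINT W|gauss_matrix (m n) n. (\<Sum>i<m n. D n i W)\<^sup>2) / (real n)\<^sup>2" by simp
      also have "\<dots> \<le> (real (m n) + (real (m n))\<^sup>2 * \<bar>f n (q n)\<bar>) / (real n)\<^sup>2"
        using second elim by (intro divide_right_mono) auto
      also have "\<dots> = real (m n) / real n * inverse (real n) + (real (m n) / real n)\<^sup>2 * \<bar>f n (q n)\<bar>"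
        by (simp add: add_divide_distrib power_divide power2_eq_square field_simps)
      finally show ?case .
    qed
  qed
  then show ?thesis unfolding D_def .
qed

text \<open>Below \<open>c_star\<close> the expected proportion satisfies \<open>c * p < 1\<close>,
  so \<open>n\<close> active rows would require a deviation of order \<open>n\<close> from
  \<open>m n * p\<close>, while the second moment is of smaller order than n^2.\<close>

lemma prob_many_active_rows_tendsto_0:
  fixes m :: "nat \<Rightarrow> nat" and c :: real
  assumes ratio: "(\<lambda>n. real (m n) / real n) \<longlonglongrightarrow> c" and "c > 0" "c < c_star"
  shows "(\<lambda>n. measure (gauss_matrix (m n) n) {W \<in> space (gauss_matrix (m n) n).
      n \<le> card {i. i < m n \<and> (\<Sum>j<n. W (i, j) * (\<Sum>l<m n. W (l, j))) \<le> 0}}) \<longlonglongrightarrow> 0"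
proof -
  interpret P: prob_space "gauss_matrix (m n) n" for n by (rule prob_space_gauss_matrix)
  define p where "p = cdf std_normal_distribution (- (1 / sqrt c))"
  have cp: "c * p < 1"
    unfolding p_def by (rule times_cdf_less_1_below_solution[OF \<open>c > 0\<close> \<open>c < c_star\<close> c_star_props(2)])
  define S where "S n W = (\<Sum>i<m n. indicator {..0} (row_score (m n) n i W) - p)" for n W
  have [measurable]: "S n \<in> borel_measurable (gauss_matrix (m n) n)" for n
    unfolding S_def by measurable
  have lim_r: "(\<lambda>n. 1 - real (m n) / real n * p) \<longlonglongrightarrow> 1 - c * p"
    by (intro tendsto_intros ratio)
  have "(\<lambda>n. (LINT W|gauss_matrix (m n) n. (S n W)\<^sup>2) / (real n)\<^sup>2 / (1 - real (m n) / real n * p)\<^sup>2)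
      \<longlonglongrightarrow> 0 / (1 - c * p)\<^sup>2"
    unfolding S_def p_def
    by (intro tendsto_divide active_rows_second_moment[OF ratio \<open>c > 0\<close>] tendsto_power
        lim_r[unfolded p_def]) (use cp in \<open>auto simp: p_def\<close>)
  then have bound_lim: "(\<lambda>n. (LINT W|gauss_matrix (m n) n. (S n W)\<^sup>2) / (real n)\<^sup>2 /
      (1 - real (m n) / real n * p)\<^sup>2) \<longlonglongrightarrow> 0" by simp
  have "\<forall>\<^sub>F n in sequentially. 1 - real (m n) / real n * p > 0"
    using cp by (intro order_tendstoD(1)[OF lim_r]) simp
  moreover have "\<forall>\<^sub>F n in sequentially. real (m n) / real n > 0"
    using order_tendstoD(1)[OF ratio] \<open>c > 0\<close> by simp
  ultimately have "\<forall>\<^sub>F n in sequentially. norm (measure (gauss_matrix (m n) n) {W \<in> space (gauss_matrix (m n) n).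
      n \<le> card {i. i < m n \<and> (\<Sum>j<n. W (i, j) * (\<Sum>l<m n. W (l, j))) \<le> 0}}) \<le>
    (LINT W|gauss_matrix (m n) n. (S n W)\<^sup>2) / (real n)\<^sup>2 / (1 - real (m n) / real n * p)\<^sup>2"
  proof eventually_elim
    case (elim n)
    then have n: "n > 0" "m n > 0" by (auto simp: zero_less_divide_iff)
    define A where "A W = {i. i < m n \<and> (\<Sum>j<n. W (i, j) * (\<Sum>l<m n. W (l, j))) \<le> 0}" for W :: "nat \<times> nat \<Rightarrow> real"
    have S: "S n W = real (card (A W)) - real (m n) * p" for W
    proof -
      \<comment> \<open>The normalising factor is positive because \<open>m n\<close> and
        \<open>n\<close> are, so it does not change the sign of the score.\<close>
      have A: "A W = {..<m n} \<inter> {i. row_score (m n) n i W \<in> {..0}}"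
        using n by (auto simp: A_def row_score_def divide_le_0_iff mult_le_0_iff)
      have "(\<Sum>i<m n. indicator {..0} (row_score (m n) n i W)) = real (card (A W))"
        unfolding A by (simp add: indicator_def sum.If_cases of_bool_def)
      then show ?thesis by (simp add: S_def sum_subtractf)
    qed
    \<comment> \<open>The margin between the critical count \<open>n\<close> and the centring
      \<open>m n * p\<close>; it is the deviation that enters Chebyshev's inequality.\<close>
    define e where "e = real n - real (m n) * p"
    have e: "e = real n * (1 - real (m n) / real n * p)" using n by (simp add: e_def right_diff_distrib)
    then have "e > 0" using n elim by simp
    have intS: "integrable (gauss_matrix (m n) n) (\<lambda>W. (S n W)\<^sup>2)"
    proof (rule P.integrable_const_bound[where B="(real (m n) * (1 + \<bar>p\<bar>))\<^sup>2"])
      have "\<bar>S n W\<bar> \<le> real (m n) * (1 + \<bar>p\<bar>)" for W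
      proof -
        have "\<bar>S n W\<bar> \<le> (\<Sum>i<m n. \<bar>indicator {..0} (row_score (m n) n i W) - p\<bar>)"
          unfolding S_def by (rule sum_abs)
        also have "\<dots> \<le> (\<Sum>i<m n. 1 + \<bar>p\<bar>)" by (intro sum_mono) (auto simp: indicator_def)
        finally show ?thesis by simp
      qed
      then show "AE W in gauss_matrix (m n) n. norm ((S n W)\<^sup>2) \<le> (real (m n) * (1 + \<bar>p\<bar>))\<^sup>2"
        by (intro AE_I2) (simp add: abs_le_square_iff[symmetric])
    qed measurable
    have "measure (gauss_matrix (m n) n) {W \<in> space (gauss_matrix (m n) n). n \<le> card (A W)} \<le>
        measure (gauss_matrix (m n) n) {W \<in> space (gauss_matrix (m n) n). (S n W)\<^sup>2 \<ge> e\<^sup>2}"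
    proof (intro P.finite_measure_mono)
      show "{W \<in> space (gauss_matrix (m n) n). n \<le> card (A W)} \<subseteq>
          {W \<in> space (gauss_matrix (m n) n). (S n W)\<^sup>2 \<ge> e\<^sup>2}"
        using \<open>e > 0\<close> by (auto simp: S e_def intro!: power_mono)
    qed measurable
    also have "\<dots> \<le> (LINT W|gauss_matrix (m n) n. (S n W)\<^sup>2) / e\<^sup>2"
      using \<open>e > 0\<close> by (intro integral_Markov_inequality_measure[where A="{}"] intS) auto
    finally show ?case unfolding A_def e by (simp add: power_mult_distrib)
  qed
  from Lim_null_comparison[OF this bound_lim] show ?thesis .
qed

theorem theorem6:
  fixes m :: "nat \<Rightarrow> nat" and c :: real
  assumes ratio: "(\<lambda>n. real (m n) / real n) \<longlonglongrightarrow> c"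
    and below: "c < c_star"
  shows "(\<lambda>n. measure (gauss_matrix (m n) n)
            {W \<in> space (gauss_matrix (m n) n).
               \<not> inj_on (relu_layer (m n) n W) ({..<n} \<rightarrow>\<^sub>E (UNIV :: real set))})
         \<longlonglongrightarrow> 1"
proof -
  interpret P: prob_space "gauss_matrix (m n) n" for n by (rule prob_space_gauss_matrix)
  define many where "many n = {W \<in> space (gauss_matrix (m n) n).
      n \<le> card {i. i < m n \<and> (\<Sum>j<n. W (i, j) * (\<Sum>l<m n. W (l, j))) \<le> 0}}" for n
  define noninj where "noninj n = {W \<in> space (gauss_matrix (m n) n).
      \<not> inj_on (relu_layer (m n) n W) ({..<n} \<rightarrow>\<^sub>E (UNIV :: real set))}" for n
  have many: "many n \<in> sets (gauss_matrix (m n) n)" for n unfolding many_def by measurable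
  have lower: "1 - measure (gauss_matrix (m n) n) (many n) \<le> measure (gauss_matrix (m n) n) (noninj n)" for n
    unfolding P.prob_compl[OF many, symmetric]
  proof (intro P.finite_measure_mono)
    show "space (gauss_matrix (m n) n) - many n \<subseteq> noninj n"
    proof
      fix W assume W: "W \<in> space (gauss_matrix (m n) n) - many n"
      then have "card {i. i < m n \<and> (\<Sum>j<n. W (i, j) * (\<Sum>l<m n. W (l, j))) \<le> 0} < n"
        by (auto simp: many_def)
      from relu_layer_not_inj[OF this] show "W \<in> noninj n" using W by (simp add: noninj_def)
    qed
    show "noninj n \<in> sets (gauss_matrix (m n) n)"
      unfolding noninj_def by (rule sets_relu_layer_not_inj)
  qed
  have "c \<ge> 0" by (rule LIMSEQ_le_const[OF ratio]) auto
  have "(\<lambda>n. measure (gauss_matrix (m n) n) (many n)) \<longlonglongrightarrow> 0"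
  \<comment> \<open>For \<open>c = 0\<close> the mean \<open>1 / sqrt c\<close> is only a default
    value and the limit law is meaningless. Here eventually \<open>m n < n\<close>, so there are too
    few rows altogether.\<close>
  proof (cases "c = 0")
    case True
    have "\<forall>\<^sub>F n in sequentially. real (m n) / real n < 1"
      using order_tendstoD(2)[OF ratio] True by simp
    then have "\<forall>\<^sub>F n in sequentially. measure (gauss_matrix (m n) n) (many n) = 0"
      using eventually_gt_at_top[of 0]
    proof eventually_elim
      case (elim n)
      have "card {i. i < m n \<and> P i} \<le> m n" for P
        using card_mono[of "{..<m n}" "{i. i < m n \<and> P i}"] by auto
      then have "\<not> n \<le> card {i. i < m n \<and> P i}" for P
        using elim by (metis divide_less_eq_1_pos linorder_not_less of_nat_0_less_iff of_nat_less_iff order_trans)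
      then have "many n = {}" by (simp add: many_def)
      then show ?case by simp
    qed
    then show ?thesis by (rule tendsto_eventually)
  next
    case False
    then show ?thesis
      unfolding many_def using \<open>c \<ge> 0\<close> by (intro prob_many_active_rows_tendsto_0[OF ratio _ below]) auto
  qed
  then have "(\<lambda>n. 1 - measure (gauss_matrix (m n) n) (many n)) \<longlonglongrightarrow> 1 - 0"
    by (intro tendsto_intros)
  then have "(\<lambda>n. 1 - measure (gauss_matrix (m n) n) (many n)) \<longlonglongrightarrow> 1" by simp
  then have "(\<lambda>n. measure (gauss_matrix (m n) n) (noninj n)) \<longlonglongrightarrow> 1"
    by (rule tendsto_sandwich[OF always_eventually always_eventually _ tendsto_const, rotated 2])
      (auto simp: lower)
  then show ?thesis unfolding noninj_def .
qed

end
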